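(* There is an absolute constant $C>0$ such that the following holds. Let $n\ge 1$, let $f:\{0,1\}^n\times\{0,1\}^n\to\{0,1\}$, and let $\mu$ be a product distribution on $\{0,1\}^n\times\{0,1\}^n$. Then $$\mathsf{CC}^\mu_{0.49}(f)\le C\left(\mathsf{IC}_{1/8}(f)\cdot\log \mathsf{IC}_{1/8}(f)\right)^2 + C$$ and $$\mathsf{CC}^\mu_{0.49}(f)\le C\left(\log \mathsf{prt}_{1/8}(f)\cdot\log\log \mathsf{prt}_{1/8}(f)\right)^2 + C.$$
   Context: Two-party communication model: Alice gets $x\in\mathcal X$, Bob gets $y\in\mathcal Y$. A distribution $\mu$ on $\mathcal X\times\mathcal Y$ is a product distribution if $\mu(x,y)=\mu_X(x)\mu_Y(y)$ for distributions $\mu_X,\mu_Y$. $\mathsf{CC}^\mu_\epsilon(f)$ (distributional communication complexity) is the minimum, over deterministic protocols computing $f$ with error probability at most $\epsilon$ when $(x,y)\sim\mu$, of the worst-case number of bits communicated. A rectangle is a set $A\times B$ with $A\subseteq\mathcal X$, $B\subseteq \mathcal Y$. All logarithms are base 2. Information complexity: for a randomized (public-coin) protocol $\Pi$ and distribution $\mu$ on inputs, with $(X,Y)\sim\mu$ and $T_\Pi$ the transcript including public randomness, $\mathsf{IC}^\mu(\Pi)=I[X:T_\Pi\mid Y]+I[Y:T_\Pi\mid X]$. $\mathsf{IC}^\mu_\epsilon(f)=\min_\Pi \mathsf{IC}^\mu(\Pi)$ over protocols computing $f$ with error at most $\epsilon$ under $\mu$, and $\mathsf{IC}_\epsilon(f)=\max_\mu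 \mathsf{IC}^\mu_\epsilon(f)$. Partition bound: for $f:\mathcal X\times\mathcal Y\to\mathcal Z$ and $\epsilon\in(0,1)$, $\mathsf{prt}_\epsilon(f)$ is the optimal value of the LP: minimize $\sum_{z\in\mathcal Z}\sum_R w_{z,R}$ (over all rectangles $R$) subject to $\sum_{R\ni(x,y)} w_{f(x,y),R}\ge 1-\epsilon$ for all $(x,y)$; $\sum_{R\ni(x,y)}\sum_z w_{z,R}=1$ for all $(x,y)$; $w_{z,R}\ge 0$. *)

theory Defs
  imports "HOL-Probability.Probability_Mass_Function"
begin

definition cube :: "nat \<Rightarrow> bool list set" where
  "cube n = {xs. length xs = n}"

text \<open>Deterministic two-party protocol trees. An ANode is owned by Alice (she sends
  the bit g x), a BNode by Bob (he sends g y); on bit True go to the left subtree.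
  Leaves carry the output.\<close>
datatype ('x, 'y, 'z) dprot =
    Leaf 'z
  | ANode "'x \<Rightarrow> bool" "('x, 'y, 'z) dprot" "('x, 'y, 'z) dprot"
  | BNode "'y \<Rightarrow> bool" "('x, 'y, 'z) dprot" "('x, 'y, 'z) dprot"

primrec deval :: "('x, 'y, 'z) dprot \<Rightarrow> 'x \<Rightarrow> 'y \<Rightarrow> 'z" where
  "deval (Leaf z) x y = z"
| "deval (ANode g l r) x y = (if g x then deval l x y else deval r x y)"
| "deval (BNode g l r) x y = (if g y then deval l x y else deval r x y)"

primrec depth :: "('x, 'y, 'z) dprot \<Rightarrow> nat" where
  "depth (Leaf z) = 0"
| "depth (ANode g l r) = Suc (max (depth l) (depth r))"
| "depth (BNode g l r) = Suc (max (depth l) (depth r))"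

primrec trans :: "('x, 'y, 'z) dprot \<Rightarrow> 'x \<Rightarrow> 'y \<Rightarrow> bool list" where
  "trans (Leaf z) x y = []"
| "trans (ANode g l r) x y = g x # (if g x then trans l x y else trans r x y)"
| "trans (BNode g l r) x y = g y # (if g y then trans l x y else trans r x y)"

type_synonym bprot = "(bool list, bool list, bool) dprot"

definition input_dist :: "nat \<Rightarrow> (bool list \<times> bool list) pmf \<Rightarrow> bool" where
  "input_dist n \<mu> \<longleftrightarrow> set_pmf \<mu> \<subseteq> cube n \<times> cube n"

definition product_dist :: "(bool list \<times> bool list) pmf \<Rightarrow> bool" where
  "product_dist \<mu> \<longleftrightarrow> (\<exists>p q. \<mu> = pair_pmf p q)"

definition det_err :: "(bool list \<times> bool list) pmf \<Rightarrow> (bool list \<Rightarrow> bool list \<Rightarrow> bool) \<Rightarrow> bprot \<Rightarrow> real" where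
  "det_err \<mu> f P = measure_pmf.prob \<mu> {(x, y). deval P x y \<noteq> f x y}"

definition CC_dist :: "(bool list \<times> bool list) pmf \<Rightarrow> real \<Rightarrow> (bool list \<Rightarrow> bool list \<Rightarrow> bool) \<Rightarrow> nat" where
  "CC_dist \<mu> \<epsilon> f = (LEAST d. \<exists>P::bprot. depth P = d \<and> det_err \<mu> f P \<le> \<epsilon>)"

text \<open>Conditional mutual information I[A:B|C] (base 2) of a finitely supported joint
  distribution of (A,B,C).\<close>
definition cmi :: "('a \<times> 'b \<times> 'c) pmf \<Rightarrow> real" where
  "cmi J = (\<Sum>t\<in>set_pmf J. case t of (a, b, c) \<Rightarrow>
      pmf J (a, b, c) *
      log 2 ((pmf J (a, b, c) * pmf (map_pmf (\<lambda>(a, b, c). c) J) c) /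
             (pmf (map_pmf (\<lambda>(a, b, c). (a, c)) J) (a, c) *
              pmf (map_pmf (\<lambda>(a, b, c). (b, c)) J) (b, c))))"

text \<open>A public-coin randomized protocol is a finitely supported distribution over
  deterministic protocols; the public randomness is the chosen protocol, and the
  full transcript is (chosen protocol, communicated bits).\<close>
definition rand_err :: "(bool list \<times> bool list) pmf \<Rightarrow> (bool list \<Rightarrow> bool list \<Rightarrow> bool) \<Rightarrow> bprot pmf \<Rightarrow> real" where
  "rand_err \<mu> f RP = measure_pmf.prob (pair_pmf \<mu> RP) {((x, y), P). deval P x y \<noteq> f x y}"

definition IC_prot :: "(bool list \<times> bool list) pmf \<Rightarrow> bprot pmf \<Rightarrow> real" where
  "IC_prot \<mu> RP =
     cmi (map_pmf (\<lambda>((x, y), P). (x, (P, trans P x y), y)) (pair_pmf \<mu> RP)) +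
     cmi (map_pmf (\<lambda>((x, y), P). (y, (P, trans P x y), x)) (pair_pmf \<mu> RP))"

definition IC_dist :: "(bool list \<times> bool list) pmf \<Rightarrow> real \<Rightarrow> (bool list \<Rightarrow> bool list \<Rightarrow> bool) \<Rightarrow> real" where
  "IC_dist \<mu> \<epsilon> f = Inf {IC_prot \<mu> RP | RP. finite (set_pmf RP) \<and> rand_err \<mu> f RP \<le> \<epsilon>}"

definition IC :: "nat \<Rightarrow> real \<Rightarrow> (bool list \<Rightarrow> bool list \<Rightarrow> bool) \<Rightarrow> real" where
  "IC n \<epsilon> f = Sup {IC_dist \<mu> \<epsilon> f | \<mu>. input_dist n \<mu>}"

text \<open>Partition bound. A rectangle A \<times> B is represented by the pair (A, B) with
  A, B \<subseteq> cube n; w z (A,B) is the weight of the rectangle for output z.\<close>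
definition prt_feasible :: "nat \<Rightarrow> real \<Rightarrow> (bool list \<Rightarrow> bool list \<Rightarrow> bool)
    \<Rightarrow> (bool \<Rightarrow> bool list set \<times> bool list set \<Rightarrow> real) \<Rightarrow> bool" where
  "prt_feasible n \<epsilon> f w \<longleftrightarrow>
     (\<forall>z R. w z R \<ge> 0) \<and>
     (\<forall>z R. R \<notin> Pow (cube n) \<times> Pow (cube n) \<longrightarrow> w z R = 0) \<and>
     (\<forall>x\<in>cube n. \<forall>y\<in>cube n.
        (\<Sum>R\<in>{R\<in>Pow (cube n) \<times> Pow (cube n). x \<in> fst R \<and> y \<in> snd R}. w (f x y) R) \<ge> 1 - \<epsilon>) \<and>
     (\<forall>x\<in>cube n. \<forall>y\<in>cube n.
        (\<Sum>R\<in>{R\<in>Pow (cube n) \<times> Pow (cube n). x \<in> fst R \<and> y \<in> snd R}. \<Sum>z\<in>UNIV. w z R) = 1)"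

definition prt :: "nat \<Rightarrow> real \<Rightarrow> (bool list \<Rightarrow> bool list \<Rightarrow> bool) \<Rightarrow> real" where
  "prt n \<epsilon> f = Inf {(\<Sum>z\<in>UNIV. \<Sum>R\<in>Pow (cube n) \<times> Pow (cube n). w z R) | w. prt_feasible n \<epsilon> f w}"

end

theory Submission
  imports Defs "HOL-Probability.Product_PMF"
begin

text \<open>
  Both bounds come from one statement about weights \<open>w\<^sub>j\<close> on labelled rectangles \<open>A\<^sub>j \<times> B\<^sub>j\<close> such
  that every input is covered with total weight at most 1, of which at least 0.87 carries the right
  label. For a product distribution \<open>p \<times> q\<close> consider the potential
  \<open>\<Sum>\<^sub>j w\<^sub>j a\<^sub>j b\<^sub>j ln (1 / (a\<^sub>j b\<^sub>j))\<close> with \<open>a\<^sub>j = p(A\<^sub>j)\<close> and \<open>b\<^sub>j = q(B\<^sub>j)\<close>; by concavity it does not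
  increase on average when a player reveals information. Since 0-rectangles and 1-rectangles overlap
  little and the measure is a product, a typical pair is negatively correlated in its rows or in its
  columns. Hence, as long as \<open>f\<close> is balanced, there is a 1-rectangle \<open>A \<times> B\<close> of measure exponential in
  minus the potential such that the answer to one of the questions \<open>x \<in> A\<close>, \<open>y \<in> B\<close> lowers the
  potential by a constant times the probability of \<open>yes\<close>. If the initial potential is \<open>h\<close>, then
  \<open>O(1 + h)\<close> positive answers among \<open>2\<^bsup>O(1 + h)\<^esup>\<close> questions suffice, and each positive answer is located
  by binary search with \<open>O(1 + h)\<close> bits, which gives communication \<open>O((1 + h)\<^sup>2)\<close>.

  A feasible point of the partition LP has potential at most the logarithm of its value plus 1. For a
  public-coin protocol the leaf rectangles have potential equal (up to \<open>ln 2\<close>) to its information cost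
  under \<open>p \<times> q\<close>; a minimax argument turns the protocols with small error under each distribution into
  a single mixture with small error at every input, where mixing a constant fraction of \<open>p \<times> q\<close>
  into the adversary's distribution keeps the information cost under \<open>p \<times> q\<close> under control.
\<close>

section \<open>Entropy inequalities\<close>

definition ent :: "real \<Rightarrow> real" where
  "ent t = - t * ln t"

text \<open>The Bregman divergence of \<open>t * ln t\<close> between \<open>r\<close> and 1.
  Applied to a correlation ratio it measures the deviation from independence, where the ratio is
  1.\<close>

definition gap :: "real \<Rightarrow> real" where
  "gap r = r * ln r - r + 1"

text \<open>By convexity \<open>gap\<close> lies above its tangent at \<open>s\<close>, which is the
  left-hand side.\<close>

lemma gap_tangent:
  assumes "0 \<le> r" "0 < s"
  shows "1 - s + r * ln s \<le> gap r"
proof (cases "r = 0")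
  case True then show ?thesis using assms by (simp add: gap_def)
next
  case False
  then have r: "r > 0" using assms by simp
  have "ln (s / r) \<le> s / r - 1" using r assms by (intro ln_le_minus_one) auto
  then have "r * ln (s / r) \<le> r * (s / r - 1)" using r by (intro mult_left_mono) auto
  then have "r * (ln s - ln r) \<le> s - r" using r assms by (simp add: ln_div algebra_simps)
  then show ?thesis by (simp add: gap_def algebra_simps)
qed

lemma gap_nonneg: "0 \<le> r \<Longrightarrow> 0 \<le> gap r"
  using gap_tangent[of r 1] by simp

lemma gap_1 [simp]: "gap 1 = 0" by (simp add: gap_def)

lemma gap_antimono:
  assumes "0 \<le> r" "r \<le> s" "s \<le> 1" "0 < s"
  shows "gap s \<le> gap r"
proof -
  have "s * ln s \<le> r * ln s" using assms by (intro mult_right_mono_neg) auto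
  then show ?thesis using gap_tangent[of r s] assms by (simp add: gap_def)
qed

text \<open>The threshold 9/10 is the square root of 81/100: if two nonnegative factors have a
  product below 81/100, one of them is at most 9/10.\<close>

definition \<gamma>\<^sub>0 :: real where "\<gamma>\<^sub>0 = gap (9/10)"

lemma gamma0_pos: "\<gamma>\<^sub>0 > 0"
proof -
  have "ln (10/9::real) < 10/9 - 1"
    using ln_eq_minus_one[of "10/9"] ln_le_minus_one[of "10/9"] by linarith
  moreover have "ln (10/9::real) = - ln (9/10)" by (simp add: ln_div)
  ultimately show ?thesis by (simp add: \<gamma>\<^sub>0_def gap_def)
qed

text \<open>If \<open>r * s\<close> is at least 81/100, the left side is not positive; otherwise one
  factor is at most 9/10 and its \<open>gap\<close> alone reaches \<open>\<gamma>\<^sub>0\<close>.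
  The bound is linear in \<open>r * s\<close> so that it can be averaged over pairs of
  rectangles.\<close>

lemma gap_add_ge:
  assumes "0 \<le> r" "0 \<le> s"
  shows "\<gamma>\<^sub>0 * (1 - r * s * (100/81)) \<le> gap r + gap s"
proof (cases "r * s \<ge> 81/100")
  case True
  then have "\<gamma>\<^sub>0 * (1 - r * s * (100/81)) \<le> 0"
    using gamma0_pos by (intro mult_nonneg_nonpos) auto
  then show ?thesis using gap_nonneg[OF assms(1)] gap_nonneg[OF assms(2)] by linarith
next
  case False
  have "r \<le> 9/10 \<or> s \<le> 9/10"
  proof (rule ccontr)
    assume "\<not> ?thesis"
    then have "(9/10) * (9/10) \<le> r * s" by (intro mult_mono) auto
    then show False using False by simp
  qed
  then have "\<gamma>\<^sub>0 \<le> gap r + gap s"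
    using gap_antimono[of r "9/10"] gap_antimono[of s "9/10"] gap_nonneg[OF assms(1)] gap_nonneg[OF assms(2)] assms
    unfolding \<gamma>\<^sub>0_def by fastforce
  moreover have "\<gamma>\<^sub>0 * (1 - r * s * (100/81)) \<le> \<gamma>\<^sub>0 * 1"
    using gamma0_pos assms by (intro mult_left_mono) auto
  ultimately show ?thesis by simp
qed

lemma ent_mult: "0 \<le> a \<Longrightarrow> 0 \<le> b \<Longrightarrow> ent (a * b) = b * ent a + a * ent b"
  by (cases "a = 0"; cases "b = 0") (auto simp: ent_def ln_mult algebra_simps)

lemma ent_nonneg: "0 \<le> t \<Longrightarrow> t \<le> 1 \<Longrightarrow> 0 \<le> ent t"
  by (cases "t = 0") (auto simp: ent_def mult_nonneg_nonpos)

text \<open>The product rule for \<open>ent\<close> leaves only the concavity defect in the first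
  factor, an average of \<open>gap\<close> at \<open>a1 / a\<close> and at \<open>a0 / a\<close>.
  Only the term of the positive answer is kept.\<close>

lemma ent_split:
  assumes l: "0 < l" "l < 1" and nn: "0 \<le> a1" "0 \<le> a0" "0 \<le> b"
    and a: "a = l * a1 + (1 - l) * a0"
  shows "l * (a * b) * gap (a1 / a) \<le> ent (a * b) - l * ent (a1 * b) - (1 - l) * ent (a0 * b)"
proof (cases "a = 0")
  case True
  have "l * a1 \<ge> 0" "(1 - l) * a0 \<ge> 0" using l nn by auto
  then have "l * a1 = 0" "(1 - l) * a0 = 0" using True a by linarith+
  then have "a1 = 0" "a0 = 0" using l by auto
  then show ?thesis using True by (simp add: ent_def)
next
  case False
  have "a \<ge> 0" using l nn a by auto
  then have ap: "a > 0" using False by simp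
  have e1: "ent a1 = - a * gap (a1 / a) - a1 * ln a - a1 + a"
    using ap nn by (cases "a1 = 0") (auto simp: ent_def gap_def ln_div field_simps)
  have e0: "ent a0 = - a * gap (a0 / a) - a0 * ln a - a0 + a"
    using ap nn by (cases "a0 = 0") (auto simp: ent_def gap_def ln_div field_simps)
  have g0: "0 \<le> gap (a0 / a)" using ap nn by (intro gap_nonneg) auto
  have "ent (a * b) - l * ent (a1 * b) - (1 - l) * ent (a0 * b)
      = b * (ent a - l * ent a1 - (1 - l) * ent a0) + (a - l * a1 - (1 - l) * a0) * ent b"
    using nn ap by (simp add: ent_mult algebra_simps)
  also have "\<dots> = b * (ent a - l * ent a1 - (1 - l) * ent a0)"
    using a by simp
  also have "ent a - l * ent a1 - (1 - l) * ent a0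
      = l * a * gap (a1/a) + (1 - l) * a * gap (a0/a) - (a - (l * a1 + (1 - l) * a0)) * ln a
        - (a - (l * a1 + (1 - l) * a0))"
    unfolding e1 e0 by (simp add: ent_def algebra_simps)
  also have "\<dots> = l * a * gap (a1/a) + (1 - l) * a * gap (a0/a)" using a by simp
  finally have "ent (a * b) - l * ent (a1 * b) - (1 - l) * ent (a0 * b)
      = l * (a * b) * gap (a1/a) + b * ((1 - l) * a * gap (a0/a))" by (simp add: algebra_simps)
  moreover have "b * ((1 - l) * a * gap (a0/a)) \<ge> 0" using nn l ap g0 by simp
  ultimately show ?thesis by linarith
qed

section \<open>Finite product distributions\<close>

definition prob_weights :: "'a set \<Rightarrow> ('a \<Rightarrow> real) \<Rightarrow> bool" where
  "prob_weights X p \<longleftrightarrow> (\<forall>x\<in>X. 0 \<le> p x) \<and> (\<Sum>x\<in>X. p x) = 1"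

definition mass :: "'a set \<Rightarrow> ('a \<Rightarrow> real) \<Rightarrow> 'a set \<Rightarrow> real" where
  "mass X p S = (\<Sum>x\<in>X. p x * of_bool (x \<in> S))"

definition cond :: "'a set \<Rightarrow> ('a \<Rightarrow> real) \<Rightarrow> 'a set \<Rightarrow> 'a \<Rightarrow> real" where
  "cond X p S x = p x * of_bool (x \<in> S) / mass X p S"

lemma mass_nonneg: "prob_weights X p \<Longrightarrow> 0 \<le> mass X p S"
  by (auto simp: mass_def prob_weights_def intro!: sum_nonneg)

lemma mass_mono:
  "prob_weights X p \<Longrightarrow> S \<subseteq> S' \<Longrightarrow> mass X p S \<le> mass X p S'"
  unfolding mass_def prob_weights_def by (intro sum_mono mult_left_mono) auto

lemma mass_UNIV: "prob_weights X p \<Longrightarrow> mass X p UNIV = 1"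
  by (simp add: mass_def prob_weights_def)

lemma mass_le_1: "prob_weights X p \<Longrightarrow> mass X p S \<le> 1"
  using mass_mono[of X p S UNIV] mass_UNIV[of X p] by simp

lemma mass_compl:
  assumes "prob_weights X p"
  shows "mass X p (- S) = 1 - mass X p S"
proof -
  have "mass X p S + mass X p (- S) = mass X p UNIV"
    unfolding mass_def sum.distrib[symmetric] by (intro sum.cong) auto
  then show ?thesis using mass_UNIV[OF assms] by simp
qed

lemma mass_cond: "mass X (cond X p S) S' = mass X p (S' \<inter> S) / mass X p S"
  unfolding mass_def[of X "cond X p S"] mass_def[of X p "S' \<inter> S"] cond_def sum_divide_distrib
  by (intro sum.cong) auto

lemma prob_weights_cond:
  assumes "prob_weights X p" "0 < mass X p S"
  shows "prob_weights X (cond X p S)"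
proof -
  have "(\<Sum>x\<in>X. cond X p S x) = mass X p S / mass X p S"
    by (simp only: cond_def mass_def sum_divide_distrib)
  then show ?thesis using assms by (auto simp: prob_weights_def cond_def)
qed

lemma mass_split_compl: "mass X p S' = mass X p (S' \<inter> S) + mass X p (S' \<inter> - S)"
  unfolding mass_def sum.distrib[symmetric] by (intro sum.cong) auto

lemma mass_total_prob:
  assumes "prob_weights X p" "0 < mass X p S" "mass X p S < 1"
  shows "mass X p S' = mass X p S * mass X (cond X p S) S'
    + (1 - mass X p S) * mass X (cond X p (- S)) S'"
  using assms mass_split_compl[of X p S' S] by (simp add: mass_cond mass_compl)

text \<open>Double counting: a sum over rectangles becomes the expectation, under the product
  weights, of the weight covering an input.\<close>

lemma sum_mass_prod:
  "(\<Sum>j\<in>J. c j * (mass X p (A j) * mass Y q (B j)))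
    = (\<Sum>x\<in>X. \<Sum>y\<in>Y. p x * q y * (\<Sum>j\<in>J. c j * of_bool (x \<in> A j) * of_bool (y \<in> B j)))"
proof -
  have "(\<Sum>j\<in>J. c j * (mass X p (A j) * mass Y q (B j)))
    = (\<Sum>j\<in>J. \<Sum>x\<in>X. \<Sum>y\<in>Y. p x * q y * (c j * of_bool (x \<in> A j) * of_bool (y \<in> B j)))"
    unfolding mass_def sum_product by (simp add: sum_distrib_left mult_ac)
  also have "\<dots> = (\<Sum>x\<in>X. \<Sum>j\<in>J. \<Sum>y\<in>Y. p x * q y * (c j * of_bool (x \<in> A j) * of_bool (y \<in> B j)))"
    by (rule sum.swap)
  also have "\<dots> = (\<Sum>x\<in>X. \<Sum>y\<in>Y. \<Sum>j\<in>J. p x * q y * (c j * of_bool (x \<in> A j) * of_bool (y \<in> B j)))"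
    by (intro sum.cong refl, rule sum.swap)
  finally show ?thesis by (simp add: sum_distrib_left)
qed

text \<open>\<open>G\<close> is an arbitrary function, so constants, question lists and protocols
  are all measured alike.\<close>

definition err :: "'a set \<Rightarrow> 'b set \<Rightarrow> ('a \<Rightarrow> 'b \<Rightarrow> bool) \<Rightarrow> ('a \<Rightarrow> real) \<Rightarrow> ('b \<Rightarrow> real)
    \<Rightarrow> ('a \<Rightarrow> 'b \<Rightarrow> bool) \<Rightarrow> real" where
  "err X Y f p q G = (\<Sum>x\<in>X. \<Sum>y\<in>Y. p x * q y * of_bool (G x y \<noteq> f x y))"

lemma err_split_left:
  assumes "prob_weights X p" "0 < mass X p S" "mass X p S < 1"
  shows "err X Y f p q (\<lambda>x y. if x \<in> S then G x y else G' x y) =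
    mass X p S * err X Y f (cond X p S) q G + (1 - mass X p S) * err X Y f (cond X p (- S)) q G'"
proof -
  have "mass X p S * err X Y f (cond X p S) q G + (1 - mass X p S) * err X Y f (cond X p (- S)) q G'
     = (\<Sum>x\<in>X. \<Sum>y\<in>Y. mass X p S * (cond X p S x * q y * of_bool (G x y \<noteq> f x y))
        + (1 - mass X p S) * (cond X p (-S) x * q y * of_bool (G' x y \<noteq> f x y)))"
    by (simp add: err_def sum_distrib_left sum.distrib)
  also have "\<dots> = err X Y f p q (\<lambda>x y. if x \<in> S then G x y else G' x y)"
    unfolding err_def using assms by (intro sum.cong refl) (auto simp: cond_def mass_compl)
  finally show ?thesis by simp
qed

lemma err_swap: "err X Y f p q G = err Y X (\<lambda>y x. f x y) q p (\<lambda>y x. G x y)"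
  unfolding err_def by (subst sum.swap) (simp add: mult_ac)

lemma err_split_right:
  assumes "prob_weights Y q" "0 < mass Y q S" "mass Y q S < 1"
  shows "err X Y f p q (\<lambda>x y. if y \<in> S then G x y else G' x y) =
    mass Y q S * err X Y f p (cond Y q S) G + (1 - mass Y q S) * err X Y f p (cond Y q (- S)) G'"
  unfolding err_swap[of X Y] by (rule err_split_left[OF assms])

lemma sum_prod_weights:
  "prob_weights X p \<Longrightarrow> prob_weights Y q \<Longrightarrow> (\<Sum>x\<in>X. \<Sum>y\<in>Y. p x * q y) = 1"
  by (simp add: prob_weights_def flip: sum_distrib_left)

lemma err_le_1:
  assumes "prob_weights X p" "prob_weights Y q"
  shows "err X Y f p q G \<le> 1"
proof -
  have "err X Y f p q G \<le> (\<Sum>x\<in>X. \<Sum>y\<in>Y. p x * q y)"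
    unfolding err_def using assms
    by (intro sum_mono) (auto simp: prob_weights_def)
  then show ?thesis using sum_prod_weights[OF assms] by simp
qed

lemma err_const_compl:
  assumes "prob_weights X p" "prob_weights Y q"
  shows "err X Y f p q (\<lambda>_ _. True) + err X Y f p q (\<lambda>_ _. False) = 1"
proof -
  have "err X Y f p q (\<lambda>_ _. True) + err X Y f p q (\<lambda>_ _. False) = (\<Sum>x\<in>X. \<Sum>y\<in>Y. p x * q y)"
    unfolding err_def sum.distrib[symmetric] by (intro sum.cong refl) auto
  then show ?thesis using sum_prod_weights[OF assms] by simp
qed

section \<open>Locating the first positive answer\<close>

text \<open>A triple \<open>(g, g', c)\<close> is a question put to Alice (\<open>g\<close>) and to Bob (\<open>g'\<close>); the first one
  answered positively by either player selects the subprotocol \<open>c\<close>.\<close>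

fun run_spine :: "(('a \<Rightarrow> bool) \<times> ('b \<Rightarrow> bool) \<times> ('a,'b,'z) dprot) list \<Rightarrow> ('a,'b,'z) dprot
    \<Rightarrow> 'a \<Rightarrow> 'b \<Rightarrow> 'z" where
  "run_spine [] e x y = deval e x y"
| "run_spine ((g, g', c) # qs) e x y = (if g x \<or> g' y then deval c x y else run_spine qs e x y)"

lemma run_spine_append:
  "run_spine (qs @ qs') e x y =
    (if \<exists>t\<in>set qs. fst t x \<or> fst (snd t) y then run_spine qs e x y else run_spine qs' e x y)"
  by (induction qs) (force split: if_splits)+

text \<open>One bit from each player tells whether the first half of the list contains a positive
  answer. After \<open>k\<close> halvings at most one question remains, which costs at most two more
  bits.\<close>

lemma spine_binary_search:
  assumes "length qs \<le> 2 ^ k" "\<forall>t\<in>set qs. depth (snd (snd t)) \<le> d" "depth e \<le> d"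
  shows "\<exists>P. depth P \<le> 2 * (k + 1) + d \<and> (\<forall>x y. deval P x y = run_spine qs e x y)"
  using assms
proof (induction k arbitrary: qs)
  case 0
  show ?case
  proof (cases qs)
    case Nil
    then show ?thesis using 0 by (intro exI[of _ e]) auto
  next
    case (Cons t ts)
    obtain g g' c where t: "t = (g, g', c)" by (cases t) auto
    have "ts = []" using 0 Cons by simp
    then show ?thesis using 0 Cons t by (intro exI[of _ "ANode g c (BNode g' c e)"]) auto
  qed
next
  case (Suc k)
  define u v where "u = take (2^k) qs" and "v = drop (2^k) qs"
  have qs: "qs = u @ v" by (simp add: u_def v_def)
  have "set u \<subseteq> set qs" "set v \<subseteq> set qs" using qs by auto
  then have "\<forall>t\<in>set u. depth (snd (snd t)) \<le> d" "\<forall>t\<in>set v. depth (snd (snd t)) \<le> d"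
    using Suc.prems by auto
  moreover have "length u \<le> 2^k" "length v \<le> 2^k" using Suc.prems by (auto simp: u_def v_def)
  ultimately obtain P1 P2 where
    P1: "depth P1 \<le> 2 * (k + 1) + d" "\<And>x y. deval P1 x y = run_spine u e x y" and
    P2: "depth P2 \<le> 2 * (k + 1) + d" "\<And>x y. deval P2 x y = run_spine v e x y"
    using Suc.IH[of u] Suc.IH[of v] Suc.prems(3) by blast
  show ?case
    using P1 P2
    by (intro exI[of _ "ANode (\<lambda>x. \<exists>t\<in>set u. fst t x) P1 (BNode (\<lambda>y. \<exists>t\<in>set u. fst (snd t) y) P1 P2)"])
      (auto simp: qs run_spine_append)
qed

section \<open>Weighted rectangle covers\<close>

text \<open>The bound 87/100 is slightly below 7/8, which leaves room for the losses in the minimax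
  argument.\<close>

locale rectangle_cover =
  fixes X :: "'a set" and Y :: "'b set" and J :: "'j set" and w :: "'j \<Rightarrow> real"
    and A :: "'j \<Rightarrow> 'a set" and B :: "'j \<Rightarrow> 'b set" and lab :: "'j \<Rightarrow> bool"
    and f :: "'a \<Rightarrow> 'b \<Rightarrow> bool"
  assumes finite_J: "finite J" and w_nonneg: "\<And>j. j \<in> J \<Longrightarrow> 0 \<le> w j"
    and cover: "\<And>x y. x \<in> X \<Longrightarrow> y \<in> Y \<Longrightarrow> (\<Sum>j\<in>J. w j * of_bool (x \<in> A j) * of_bool (y \<in> B j)) \<le> 1"
    and correct: "\<And>x y. x \<in> X \<Longrightarrow> y \<in> Y \<Longrightarrow>
      87/100 \<le> (\<Sum>j\<in>J. w j * of_bool (lab j = f x y) * of_bool (x \<in> A j) * of_bool (y \<in> B j))"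
begin

section \<open>Scores, potential and overlap of a cover\<close>

definition score :: "bool \<Rightarrow> 'a \<Rightarrow> 'b \<Rightarrow> real" where
  "score z x y = (\<Sum>j\<in>J. w j * of_bool (lab j = z) * of_bool (x \<in> A j) * of_bool (y \<in> B j))"

definition pot :: "('a \<Rightarrow> real) \<Rightarrow> ('b \<Rightarrow> real) \<Rightarrow> real" where
  "pot p q = (\<Sum>j\<in>J. w j * ent (mass X p (A j) * mass Y q (B j)))"

lemma score_nonneg: "0 \<le> score z x y"
  unfolding score_def using w_nonneg by (intro sum_nonneg) auto

lemma score_add_le_1: "x \<in> X \<Longrightarrow> y \<in> Y \<Longrightarrow> score True x y + score False x y \<le> 1"
proof -
  assume xy: "x \<in> X" "y \<in> Y"
  have "score True x y + score False x y = (\<Sum>j\<in>J. w j * of_bool (x \<in> A j) * of_bool (y \<in> B j))"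
    unfolding score_def sum.distrib[symmetric] by (intro sum.cong refl) auto
  then show ?thesis using cover[OF xy] by simp
qed

lemma score_correct: "x \<in> X \<Longrightarrow> y \<in> Y \<Longrightarrow> 87/100 \<le> score (f x y) x y"
  unfolding score_def by (rule correct)

text \<open>The right label has a score \<open>u\<close> of at least 87/100 and the other one at
  most \<open>1 - u\<close>. Since \<open>u * (1 - u)\<close> decreases beyond 1/2, the product is
  at most 87/100 * 13/100.\<close>

lemma score_prod_le:
  assumes "x \<in> X" "y \<in> Y"
  shows "score False x y * score True x y \<le> 1131/10000"
proof -
  have *: "u * v \<le> 1131/10000" if "87/100 \<le> u" "0 \<le> v" "u + v \<le> 1" for u v :: real
  proof -
    have "u * v \<le> u * (1 - u)" using that by (intro mult_left_mono) auto
    moreover have "0 \<le> (u - 87/100) * (u - 13/100)" using that by (intro mult_nonneg_nonneg) auto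
    moreover have "(u - 87/100) * (u - 13/100) = 1131/10000 - u * (1 - u)" by (simp add: field_simps)
    ultimately show ?thesis by linarith
  qed
  show ?thesis
    using *[of "score True x y" "score False x y"] *[of "score False x y" "score True x y"]
      score_correct[OF assms] score_add_le_1[OF assms] score_nonneg
    by (cases "f x y") (auto simp: mult.commute)
qed

lemma sum_w_mass_le_1:
  assumes "prob_weights X p" "prob_weights Y q"
  shows "(\<Sum>j\<in>J. w j * (mass X p (A j) * mass Y q (B j))) \<le> 1"
proof -
  have "(\<Sum>j\<in>J. w j * (mass X p (A j) * mass Y q (B j))) \<le> (\<Sum>x\<in>X. \<Sum>y\<in>Y. p x * q y * 1)"
    unfolding sum_mass_prod using assms
    by (intro sum_mono mult_left_mono cover) (auto simp: prob_weights_def)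
  then show ?thesis using sum_prod_weights[OF assms] by simp
qed

lemma pot_nonneg:
  assumes "prob_weights X p" "prob_weights Y q"
  shows "0 \<le> pot p q"
  unfolding pot_def using assms w_nonneg
  by (intro sum_nonneg mult_nonneg_nonneg ent_nonneg)
    (auto simp: mass_nonneg mass_le_1 intro!: mult_le_one)

text \<open>The error of the constant answer \<open>\<not> z\<close> is the probability that
  \<open>f\<close> equals \<open>z\<close>, and such inputs are covered with weight at least 87/100
  by rectangles labelled \<open>z\<close>.\<close>

lemma sum_lab_mass_ge:
  assumes "prob_weights X p" "prob_weights Y q"
  shows "87/100 * err X Y f p q (\<lambda>_ _. \<not> z)
    \<le> (\<Sum>j\<in>J. w j * of_bool (lab j = z) * (mass X p (A j) * mass Y q (B j)))"
  unfolding sum_mass_prod score_def[symmetric] err_def sum_distrib_left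
proof (intro sum_mono)
  fix x y assume xy: "x \<in> X" "y \<in> Y"
  have "87/100 * of_bool ((\<not> z) \<noteq> f x y) \<le> score z x y"
    using score_correct[OF xy] score_nonneg[of z x y] by auto
  then have "p x * q y * (87/100 * of_bool ((\<not> z) \<noteq> f x y)) \<le> p x * q y * score z x y"
    using assms xy by (intro mult_left_mono) (auto simp: prob_weights_def)
  then show "87/100 * (p x * q y * of_bool ((\<not> z) \<noteq> f x y)) \<le> p x * q y * score z x y"
    by (simp add: mult_ac)
qed

text \<open>For a product measure each summand weights the measure of the intersection of two
  rectangles with opposite labels, so the double sum is the expectation of the product of the two
  scores.\<close>

lemma sum_overlap_le:
  assumes p: "prob_weights X p" and q: "prob_weights Y q"
  shows "(\<Sum>j\<in>J. \<Sum>i\<in>J. (w j * of_bool (lab j = True)) * (w i * of_bool (lab i = False))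
    * (mass X p (A i \<inter> A j) * mass Y q (B i \<inter> B j))) \<le> 1131/10000"
proof -
  \<comment> \<open>Moving the indicator of \<open>A j\<close> into the weights makes the inner sum
    an instance of \<open>sum_mass_prod\<close>.\<close>
  have 1: "mass X p (A i \<inter> A j) = mass X (\<lambda>x. p x * of_bool (x \<in> A j)) (A i)" for i j
    unfolding mass_def by (intro sum.cong) auto
  have 2: "mass Y q (B i \<inter> B j) = mass Y (\<lambda>x. q x * of_bool (x \<in> B j)) (B i)" for i j
    unfolding mass_def by (intro sum.cong) auto
  have "(\<Sum>j\<in>J. \<Sum>i\<in>J. (w j * of_bool (lab j = True)) * (w i * of_bool (lab i = False))
    * (mass X p (A i \<inter> A j) * mass Y q (B i \<inter> B j)))
   = (\<Sum>j\<in>J. (w j * of_bool (lab j = True)) * (\<Sum>i\<in>J. (w i * of_bool (lab i = False))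
    * (mass X (\<lambda>x. p x * of_bool (x \<in> A j)) (A i) * mass Y (\<lambda>x. q x * of_bool (x \<in> B j)) (B i))))"
    by (simp add: sum_distrib_left 1 2 mult.assoc)
  also have "\<dots> = (\<Sum>j\<in>J. \<Sum>x\<in>X. \<Sum>y\<in>Y. p x * q y * score False x y *
      (w j * of_bool (lab j = True) * of_bool (x \<in> A j) * of_bool (y \<in> B j)))"
    unfolding sum_mass_prod score_def[symmetric]
    by (simp add: sum_distrib_left mult_ac)
  also have "\<dots> = (\<Sum>x\<in>X. \<Sum>j\<in>J. \<Sum>y\<in>Y. p x * q y * score False x y *
      (w j * of_bool (lab j = True) * of_bool (x \<in> A j) * of_bool (y \<in> B j)))"
    by (rule sum.swap)
  also have "\<dots> = (\<Sum>x\<in>X. \<Sum>y\<in>Y. \<Sum>j\<in>J. p x * q y * score False x y *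
      (w j * of_bool (lab j = True) * of_bool (x \<in> A j) * of_bool (y \<in> B j)))"
    by (intro sum.cong refl, rule sum.swap)
  also have "\<dots> = (\<Sum>x\<in>X. \<Sum>y\<in>Y. p x * q y * (score False x y * score True x y))"
    unfolding sum_distrib_left[symmetric] score_def[symmetric] by (simp add: mult_ac)
  also have "\<dots> \<le> (\<Sum>x\<in>X. \<Sum>y\<in>Y. p x * q y * (1131/10000))"
    using p q by (intro sum_mono mult_left_mono score_prod_le) (auto simp: prob_weights_def)
  also have "\<dots> = 1131/10000"
    unfolding sum_distrib_right[symmetric] using sum_prod_weights[OF p q] by simp
  finally show ?thesis .
qed

text \<open>Rectangles with opposite labels have total overlap at most 0.1131, whereas for balanced
  \<open>f\<close> the products of their measures sum to at least 0.187. So the product of row and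
  column correlation is on average well below 81/100, and \<open>gap_add_ge\<close> turns this into
  a gain in rows or in columns.\<close>

lemma exists_informative_question:
  assumes p: "prob_weights X p" and q: "prob_weights Y q"
    and bal: "9/20 \<le> err X Y f p q (\<lambda>_ _. True)" "9/20 \<le> err X Y f p q (\<lambda>_ _. False)"
    and H: "pot p q \<le> H" "0 < H"
  shows "\<exists>j\<in>J. exp (- 100 * H) \<le> mass X p (A j) * mass Y q (B j) \<and>
    (\<gamma>\<^sub>0 / 100 \<le> (\<Sum>i\<in>J. w i * (mass X p (A i) * mass Y q (B i)) *
        gap (mass X p (A i \<inter> A j) / (mass X p (A i) * mass X p (A j)))) \<or>
     \<gamma>\<^sub>0 / 100 \<le> (\<Sum>i\<in>J. w i * (mass X p (A i) * mass Y q (B i)) *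
        gap (mass Y q (B i \<inter> B j) / (mass Y q (B i) * mass Y q (B j)))))"
proof -
  define a b where "a i = mass X p (A i)" and "b i = mass Y q (B i)" for i
  define r s where "r i j = mass X p (A i \<inter> A j) / (a i * a j)"
    and "s i j = mass Y q (B i \<inter> B j) / (b i * b j)" for i j
  define u v where "u i = w i * of_bool (lab i = False) * (a i * b i)"
    and "v i = w i * of_bool (lab i = True) * (a i * b i)" for i
  \<comment> \<open>\<open>r i j\<close> and \<open>s i j\<close> measure the correlation of rectangles \<open>i\<close> and \<open>j\<close> in rows and in columns.
    \<open>E j\<close> bounds the total gain of the two questions belonging to \<open>j\<close> from below, and unlike that
    gain it is bounded from above, which is needed to exclude small rectangles.\<close>
  define E where "E j = (\<Sum>i\<in>J. u i * (\<gamma>\<^sub>0 * (1 - r i j * s i j * (100/81))))" for j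
  have ab: "0 \<le> a i" "a i \<le> 1" "0 \<le> b i" "b i \<le> 1" for i
    using p q by (auto simp: a_def b_def mass_nonneg mass_le_1)
  have rs: "0 \<le> r i j" "0 \<le> s i j" for i j
    using p q ab by (auto simp: r_def s_def mass_nonneg)
  have uv: "0 \<le> u i" "0 \<le> v i" "u i + v i = w i * (a i * b i)" if "i \<in> J" for i
    using w_nonneg[OF that] ab by (auto simp: u_def v_def)
  have r_mult: "a i * a j * r i j = mass X p (A i \<inter> A j)" for i j
  proof (cases "a i * a j = 0")
    \<comment> \<open>The ratio is 0 by division by zero, which is still correct because the
      intersection is null as well.\<close>
    case True
    have "mass X p (A i \<inter> A j) \<le> a i" "mass X p (A i \<inter> A j) \<le> a j"
      unfolding a_def by (intro mass_mono p; auto)+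
    then have "mass X p (A i \<inter> A j) = 0"
      using True mass_nonneg[OF p, of "A i \<inter> A j"] by auto
    then show ?thesis using True by simp
  qed (simp add: r_def)
  have s_mult: "b i * b j * s i j = mass Y q (B i \<inter> B j)" for i j
  proof (cases "b i * b j = 0")
    case True
    have "mass Y q (B i \<inter> B j) \<le> b i" "mass Y q (B i \<inter> B j) \<le> b j"
      unfolding b_def by (intro mass_mono q; auto)+
    then have "mass Y q (B i \<inter> B j) = 0"
      using True mass_nonneg[OF q, of "B i \<inter> B j"] by auto
    then show ?thesis using True by simp
  qed (simp add: s_def)
  let ?P = "\<Sum>i\<in>J. u i" and ?Q = "\<Sum>j\<in>J. v j"
  have PQ1: "?P + ?Q \<le> 1"
    using sum_w_mass_le_1[OF p q] uv(3) by (simp add: sum.distrib[symmetric] a_def b_def)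
  have P0: "0 \<le> ?P" "0 \<le> ?Q" using uv by (auto intro: sum_nonneg)
  \<comment> \<open>Balance puts \<open>e\<close> between 9/20 and 11/20, where
    \<open>e * (1 - e)\<close> is smallest at the ends; 18733/100000 is (87/100)^2 * 9/20 * 11/20
    rounded down.\<close>
  have PQ: "18733/100000 \<le> ?P * ?Q"
  proof -
    define e where "e = err X Y f p q (\<lambda>_ _. True)"
    have e: "9/20 \<le> e" "9/20 \<le> 1 - e" "err X Y f p q (\<lambda>_ _. False) = 1 - e"
      using bal err_const_compl[OF p q, of f] by (auto simp: e_def)
    have "87/100 * e \<le> ?P" "87/100 * (1 - e) \<le> ?Q"
      using sum_lab_mass_ge[OF p q, of False] sum_lab_mass_ge[OF p q, of True] e
      unfolding u_def v_def a_def b_def e_def by (auto simp: mult.assoc)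
    then have "(87/100 * e) * (87/100 * (1 - e)) \<le> ?P * ?Q"
      using e P0 by (intro mult_mono) auto
    moreover have "0 \<le> (e - 9/20) * (11/20 - e)" using e by (intro mult_nonneg_nonneg) auto
    ultimately show ?thesis by (simp add: algebra_simps)
  qed
  have ov: "(\<Sum>j\<in>J. \<Sum>i\<in>J. v j * u i * (r i j * s i j)) \<le> 1131/10000"
  proof -
    have "v j * u i * (r i j * s i j) = (w j * of_bool (lab j = True)) * (w i * of_bool (lab i = False))
      * (mass X p (A i \<inter> A j) * mass Y q (B i \<inter> B j))" for i j
      unfolding r_mult[symmetric] s_mult[symmetric] u_def v_def by (simp add: mult_ac)
    then show ?thesis using sum_overlap_le[OF p q] by simp
  qed
  have "(\<Sum>j\<in>J. v j * E j) = (\<Sum>j\<in>J. \<Sum>i\<in>J. \<gamma>\<^sub>0 * (v j * u i) - \<gamma>\<^sub>0 * (100/81) * (v j * u i * (r i j * s i j)))"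
    unfolding E_def sum_distrib_left by (intro sum.cong refl) (simp add: algebra_simps)
  also have "\<dots> = \<gamma>\<^sub>0 * (?P * ?Q) - \<gamma>\<^sub>0 * (100/81) * (\<Sum>j\<in>J. \<Sum>i\<in>J. v j * u i * (r i j * s i j))"
    unfolding sum_subtractf sum_distrib_left[symmetric] sum_distrib_right[symmetric] by (simp add: mult_ac)
  \<comment> \<open>Numerically, 0.18733 - 0.1131 * 100/81 exceeds 1/25.\<close>
  also have "\<dots> \<ge> \<gamma>\<^sub>0 * (18733/100000) - \<gamma>\<^sub>0 * (100/81) * (1131/10000)"
    using PQ ov gamma0_pos by (intro diff_mono mult_left_mono) auto
  finally have E_sum: "\<gamma>\<^sub>0 / 25 \<le> (\<Sum>j\<in>J. v j * E j)" using gamma0_pos by simp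
  have ent_sum: "(\<Sum>j\<in>J. v j * (- ln (a j * b j))) \<le> H"
  proof -
    have "(\<Sum>j\<in>J. v j * (- ln (a j * b j))) \<le> (\<Sum>j\<in>J. w j * ent (a j * b j))"
    proof (rule sum_mono)
      fix j assume j: "j \<in> J"
      have "v j * (- ln (a j * b j)) = of_bool (lab j = True) * (w j * ent (a j * b j))"
        by (simp add: v_def ent_def)
      also have "\<dots> \<le> w j * ent (a j * b j)"
        using ab[of j] w_nonneg[OF j] by (auto intro!: ent_nonneg mult_nonneg_nonneg mult_le_one)
      finally show "v j * (- ln (a j * b j)) \<le> w j * ent (a j * b j)" .
    qed
    then show ?thesis using H by (simp add: pot_def a_def b_def)
  qed
  \<comment> \<open>The logarithmic penalty selects a rectangle that is at once informative and not too small.\<close>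
  define \<beta> where "\<beta> = \<gamma>\<^sub>0 / (100 * H)"
  have \<beta>: "\<beta> > 0" "\<beta> * H = \<gamma>\<^sub>0 / 100" using H gamma0_pos by (auto simp: \<beta>_def)
  \<comment> \<open>The sum of these terms is at least \<open>\<gamma>\<^sub>0/25 -
    \<gamma>\<^sub>0/50 - \<gamma>\<^sub>0/100\<close>, so one of them is positive.\<close>
  have "\<exists>j\<in>J. 0 < v j * (E j - \<gamma>\<^sub>0/50 - \<beta> * (- ln (a j * b j)))"
  proof (rule ccontr)
    assume "\<not> ?thesis"
    then have "(\<Sum>j\<in>J. v j * (E j - \<gamma>\<^sub>0/50 - \<beta> * (- ln (a j * b j)))) \<le> 0"
      by (intro sum_nonpos) auto
    moreover have "(\<Sum>j\<in>J. v j * (E j - \<gamma>\<^sub>0/50 - \<beta> * (- ln (a j * b j))))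
      = (\<Sum>j\<in>J. v j * E j) - ?Q * (\<gamma>\<^sub>0/50) - \<beta> * (\<Sum>j\<in>J. v j * (- ln (a j * b j)))"
      unfolding sum_distrib_left sum_distrib_right sum_subtractf[symmetric]
      by (intro sum.cong refl) (simp add: algebra_simps)
    moreover have "?Q * (\<gamma>\<^sub>0/50) \<le> 1 * (\<gamma>\<^sub>0/50)"
      using PQ1 P0 gamma0_pos by (intro mult_right_mono) auto
    moreover have "\<beta> * (\<Sum>j\<in>J. v j * (- ln (a j * b j))) \<le> \<beta> * H"
      using ent_sum \<beta> by (intro mult_left_mono) auto
    ultimately show False using E_sum \<beta>(2) gamma0_pos by linarith
  qed
  then obtain j where j: "j \<in> J" "0 < v j * (E j - \<gamma>\<^sub>0/50 - \<beta> * (- ln (a j * b j)))" by blast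
  have vj: "0 < v j" and Ej: "\<gamma>\<^sub>0/50 + \<beta> * (- ln (a j * b j)) < E j"
    using j uv(2)[OF j(1)] by (auto simp: zero_less_mult_iff)
  have abj: "0 < a j * b j" using vj w_nonneg[OF j(1)] ab[of j]
    by (metis less_eq_real_def mult_nonneg_nonneg mult_zero_right order_less_irrefl v_def)
  have lnj: "- ln (a j * b j) \<ge> 0" using ab[of j] abj by (simp add: mult_le_one)
  \<comment> \<open>\<open>E j\<close> is at most \<open>\<gamma>\<^sub>0\<close>, which equals
    \<open>\<beta> * (100 * H)\<close>; hence the penalty caps \<open>- ln (a j * b j)\<close> at
    \<open>100 * H\<close>.\<close>
  have "E j \<le> (\<Sum>i\<in>J. u i * \<gamma>\<^sub>0)"
    unfolding E_def
  proof (intro sum_mono mult_left_mono)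
    fix i assume i: "i \<in> J"
    show "0 \<le> u i" using uv i by simp
    have "\<gamma>\<^sub>0 * (1 - r i j * s i j * (100/81)) \<le> \<gamma>\<^sub>0 * 1"
      using gamma0_pos rs[of i j] by (intro mult_left_mono) auto
    then show "\<gamma>\<^sub>0 * (1 - r i j * s i j * (100/81)) \<le> \<gamma>\<^sub>0" by simp
  qed
  also have "\<dots> = ?P * \<gamma>\<^sub>0" by (simp add: sum_distrib_right)
  also have "\<dots> \<le> 1 * \<gamma>\<^sub>0" using PQ1 P0 gamma0_pos by (intro mult_right_mono) auto
  finally have "\<beta> * (- ln (a j * b j)) < \<gamma>\<^sub>0" using Ej gamma0_pos by linarith
  then have "\<beta> * (- ln (a j * b j)) < \<beta> * (100 * H)" using \<beta>(2) by linarith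
  then have "- ln (a j * b j) < 100 * H" using \<beta>(1) by (simp only: mult_less_cancel_left_pos)
  then have size: "exp (- 100 * H) \<le> a j * b j"
    using abj by (metis ln_ge_iff minus_le_iff mult_minus_left order_less_imp_le)
  \<comment> \<open>Since \<open>gap\<close> is nonnegative, the sum over 0-rectangles may be
    enlarged to all rectangles, as the potential requires.\<close>
  have "E j \<le> (\<Sum>i\<in>J. w i * (a i * b i) * (gap (r i j) + gap (s i j)))"
    unfolding E_def
  proof (rule sum_mono)
    fix i assume i: "i \<in> J"
    have g: "0 \<le> gap (r i j) + gap (s i j)" using rs by (simp add: gap_nonneg)
    have "u i * (\<gamma>\<^sub>0 * (1 - r i j * s i j * (100/81))) \<le> u i * (gap (r i j) + gap (s i j))"
      using uv(1)[OF i] rs by (intro mult_left_mono gap_add_ge) auto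
    also have "\<dots> \<le> w i * (a i * b i) * (gap (r i j) + gap (s i j))"
      using uv[OF i] g by (intro mult_right_mono) auto
    finally show "u i * (\<gamma>\<^sub>0 * (1 - r i j * s i j * (100/81))) \<le> w i * (a i * b i) * (gap (r i j) + gap (s i j))" .
  qed
  also have "\<dots> = (\<Sum>i\<in>J. w i * (a i * b i) * gap (r i j)) + (\<Sum>i\<in>J. w i * (a i * b i) * gap (s i j))"
    by (simp add: distrib_left sum.distrib)
  finally have "\<gamma>\<^sub>0/50 \<le> (\<Sum>i\<in>J. w i * (a i * b i) * gap (r i j)) + (\<Sum>i\<in>J. w i * (a i * b i) * gap (s i j))"
    using Ej mult_nonneg_nonneg[OF less_imp_le[OF \<beta>(1)] lnj] by linarith
  then have "\<gamma>\<^sub>0/100 \<le> (\<Sum>i\<in>J. w i * (a i * b i) * gap (r i j)) \<or> \<gamma>\<^sub>0/100 \<le> (\<Sum>i\<in>J. w i * (a i * b i) * gap (s i j))"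
    by linarith
  then show ?thesis using j(1) size unfolding r_def s_def a_def b_def by blast
qed

text \<open>\<open>ent_split\<close> applies to every rectangle, because its row measure is the
  average over both answers to the question \<open>x \<in> S\<close>.\<close>

lemma pot_drop_left:
  assumes p: "prob_weights X p" and q: "prob_weights Y q" and l: "0 < mass X p S" "mass X p S < 1"
  shows "mass X p S * (\<Sum>i\<in>J. w i * (mass X p (A i) * mass Y q (B i)) *
        gap (mass X p (A i \<inter> S) / (mass X p (A i) * mass X p S)))
    \<le> pot p q - mass X p S * pot (cond X p S) q - (1 - mass X p S) * pot (cond X p (- S)) q"
  unfolding pot_def sum_distrib_left sum_subtractf[symmetric]
proof (rule sum_mono)
  fix i assume i: "i \<in> J"
  let ?l = "mass X p S" and ?a = "mass X p (A i)" and ?b = "mass Y q (B i)"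
    and ?at = "mass X (cond X p S) (A i)" and ?af = "mass X (cond X p (- S)) (A i)"
  have "0 < mass X p (- S)" using l mass_compl[OF p, of S] by simp
  then have nn: "0 \<le> ?at" "0 \<le> ?af" "0 \<le> ?b"
    using p q l by (auto intro!: mass_nonneg prob_weights_cond)
  have "?l * (?a * ?b) * gap (?at / ?a) \<le> ent (?a * ?b) - ?l * ent (?at * ?b) - (1 - ?l) * ent (?af * ?b)"
    by (rule ent_split[OF l nn mass_total_prob[OF p l, of "A i"]])
  from mult_left_mono[OF this w_nonneg[OF i]]
  show "?l * (w i * (?a * ?b) * gap (mass X p (A i \<inter> S) / (?a * ?l))) \<le>
      w i * ent (?a * ?b) - ?l * (w i * ent (?at * ?b)) - (1 - ?l) * (w i * ent (?af * ?b))"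
    by (simp add: mass_cond algebra_simps)
qed

lemma pot_drop_right:
  assumes p: "prob_weights X p" and q: "prob_weights Y q" and l: "0 < mass Y q S" "mass Y q S < 1"
  shows "mass Y q S * (\<Sum>i\<in>J. w i * (mass X p (A i) * mass Y q (B i)) *
        gap (mass Y q (B i \<inter> S) / (mass Y q (B i) * mass Y q S)))
    \<le> pot p q - mass Y q S * pot p (cond Y q S) - (1 - mass Y q S) * pot p (cond Y q (- S))"
  unfolding pot_def sum_distrib_left sum_subtractf[symmetric]
proof (rule sum_mono)
  fix i assume i: "i \<in> J"
  let ?l = "mass Y q S" and ?a = "mass X p (A i)" and ?b = "mass Y q (B i)"
    and ?bt = "mass Y (cond Y q S) (B i)" and ?bf = "mass Y (cond Y q (- S)) (B i)"
  have "0 < mass Y q (- S)" using l mass_compl[OF q, of S] by simp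
  then have nn: "0 \<le> ?bt" "0 \<le> ?bf" "0 \<le> ?a"
    using p q l by (auto intro!: mass_nonneg prob_weights_cond)
  have "?l * (?b * ?a) * gap (?bt / ?b) \<le> ent (?b * ?a) - ?l * ent (?bt * ?a) - (1 - ?l) * ent (?bf * ?a)"
    by (rule ent_split[OF l nn mass_total_prob[OF q l, of "B i"]])
  from mult_left_mono[OF this w_nonneg[OF i]]
  show "?l * (w i * (?a * ?b) * gap (mass Y q (B i \<inter> S) / (?b * ?l))) \<le>
      w i * ent (?a * ?b) - ?l * (w i * ent (?a * ?bt)) - (1 - ?l) * (w i * ent (?a * ?bf))"
    by (simp add: mass_cond algebra_simps)
qed

text \<open>Unifies questions to Alice and to Bob: the player who is not asked has a constantly
  false question. The bound on \<open>l\<close> holds because a product of two probabilities is at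
  most each of them.\<close>

lemma exists_question_step:
  assumes p: "prob_weights X p" and q: "prob_weights Y q"
    and bal: "9/20 \<le> err X Y f p q (\<lambda>_ _. True)" "9/20 \<le> err X Y f p q (\<lambda>_ _. False)"
    and H: "pot p q \<le> H" "0 < H"
  obtains g g' l p1 q1 p0 q0 where
    "prob_weights X p1" "prob_weights X p0" "prob_weights Y q1" "prob_weights Y q0"
    "0 < l" "l < 1" "exp (- 100 * H) \<le> l"
    "l * (\<gamma>\<^sub>0 / 100) \<le> pot p q - l * pot p1 q1 - (1 - l) * pot p0 q0"
    "\<And>G G'. err X Y f p q (\<lambda>x y. if g x \<or> g' y then G x y else G' x y)
        = l * err X Y f p1 q1 G + (1 - l) * err X Y f p0 q0 G'"
proof -
  obtain j where j: "j \<in> J" and size: "exp (- 100 * H) \<le> mass X p (A j) * mass Y q (B j)"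
    and D: "\<gamma>\<^sub>0 / 100 \<le> (\<Sum>i\<in>J. w i * (mass X p (A i) * mass Y q (B i)) *
        gap (mass X p (A i \<inter> A j) / (mass X p (A i) * mass X p (A j)))) \<or>
     \<gamma>\<^sub>0 / 100 \<le> (\<Sum>i\<in>J. w i * (mass X p (A i) * mass Y q (B i)) *
        gap (mass Y q (B i \<inter> B j) / (mass Y q (B i) * mass Y q (B j))))"
    using exists_informative_question[OF p q bal H] by blast
  have bnd: "0 \<le> mass X p (A j)" "mass X p (A j) \<le> 1" "0 \<le> mass Y q (B j)" "mass Y q (B j) \<le> 1"
    using p q by (auto simp: mass_nonneg mass_le_1)
  have sz: "exp (- 100 * H) \<le> mass X p (A j)" "exp (- 100 * H) \<le> mass Y q (B j)"
    using size bnd mult_left_le[of "mass Y q (B j)" "mass X p (A j)"]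
      mult_left_le[of "mass X p (A j)" "mass Y q (B j)"] by (auto simp: mult.commute)
  have e0: "0 < exp (- 100 * H)" by simp
  \<comment> \<open>If the answer were surely yes, every rectangle of positive measure would have
    ratio 1 and the gain would be 0, contradicting \<open>D\<close>. This excludes
    \<open>l = 1\<close>.\<close>
  have full: "mass Z r (S \<inter> S') = mass Z r S" if "prob_weights Z r" "mass Z r S' = 1" for Z r and S S' :: "'c set"
  proof -
    have "mass Z r (S \<inter> - S') \<le> mass Z r (- S')" using that by (intro mass_mono) auto
    then have "mass Z r (S \<inter> - S') = 0"
      using that mass_compl[of Z r S'] mass_nonneg[of Z r "S \<inter> - S'"] by simp
    then show ?thesis using mass_split_compl[of Z r S S'] by simp
  qed
  from D show ?thesis
  proof
    assume D: "\<gamma>\<^sub>0 / 100 \<le> (\<Sum>i\<in>J. w i * (mass X p (A i) * mass Y q (B i)) *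
        gap (mass X p (A i \<inter> A j) / (mass X p (A i) * mass X p (A j))))" (is "_ \<le> ?D")
    have l1: "mass X p (A j) < 1"
    proof (rule ccontr)
      assume "\<not> ?thesis"
      then have one: "mass X p (A j) = 1" using bnd by simp
      have "?D = 0"
        by (rule sum.neutral) (auto simp: full[OF p one] one)
      then show False using D gamma0_pos by simp
    qed
    have l0: "0 < mass X p (A j)" using sz(1) e0 by linarith
    have "mass X p (A j) * (\<gamma>\<^sub>0 / 100) \<le> mass X p (A j) * ?D"
      using D bnd by (intro mult_left_mono) auto
    also note pot_drop_left[OF p q l0 l1]
    finally have drop: "mass X p (A j) * (\<gamma>\<^sub>0 / 100) \<le> pot p q - mass X p (A j) * pot (cond X p (A j)) q
        - (1 - mass X p (A j)) * pot (cond X p (- A j)) q" .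
    have "prob_weights X (cond X p (- A j))"
      using l1 by (intro prob_weights_cond p) (simp add: mass_compl[OF p])
    then show ?thesis
      using prob_weights_cond[OF p l0] l0 l1 q sz drop
      by (intro that[of "cond X p (A j)" "cond X p (- A j)" q q "mass X p (A j)" "\<lambda>x. x \<in> A j" "\<lambda>_. False"])
        (simp_all add: err_split_left[OF p l0 l1])
  next
    assume D: "\<gamma>\<^sub>0 / 100 \<le> (\<Sum>i\<in>J. w i * (mass X p (A i) * mass Y q (B i)) *
        gap (mass Y q (B i \<inter> B j) / (mass Y q (B i) * mass Y q (B j))))" (is "_ \<le> ?D")
    have l1: "mass Y q (B j) < 1"
    proof (rule ccontr)
      assume "\<not> ?thesis"
      then have one: "mass Y q (B j) = 1" using bnd by simp
      have "?D = 0"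
        by (rule sum.neutral) (auto simp: full[OF q one] one)
      then show False using D gamma0_pos by simp
    qed
    have l0: "0 < mass Y q (B j)" using sz(2) e0 by linarith
    have "mass Y q (B j) * (\<gamma>\<^sub>0 / 100) \<le> mass Y q (B j) * ?D"
      using D bnd by (intro mult_left_mono) auto
    also note pot_drop_right[OF p q l0 l1]
    finally have drop: "mass Y q (B j) * (\<gamma>\<^sub>0 / 100) \<le> pot p q - mass Y q (B j) * pot p (cond Y q (B j))
        - (1 - mass Y q (B j)) * pot p (cond Y q (- B j))" .
    have "prob_weights Y (cond Y q (- B j))"
      using l1 by (intro prob_weights_cond q) (simp add: mass_compl[OF q])
    then show ?thesis
      using prob_weights_cond[OF q l0] l0 l1 p sz drop
      by (intro that[of p p "cond Y q (B j)" "cond Y q (- B j)" "mass Y q (B j)" "\<lambda>_. False" "\<lambda>y. y \<in> B j"])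
        (simp_all add: err_split_right[OF q l0 l1])
  qed
qed

text \<open>Here \<open>t\<close> bounds the remaining positive answers and \<open>s\<close> the remaining questions. The bound
  \<open>F\<close> on the error is at least 1 as soon as one of these budgets is used up or the potential exceeds
  \<open>\<gamma>\<^sub>0 T / 100\<close>; otherwise a question decreases the potential term on average by at least as much as
  it increases the two budget terms.\<close>

lemma exists_protocol_bounded_questions:
  fixes T N k :: nat
  assumes T: "0 < T" and N: "real T * exp (\<gamma>\<^sub>0 * T) \<le> N" "N \<le> 2 ^ k"
  defines "F \<equiv> \<lambda>t s h. 9/20 + (real T - t) / T + (real N - s) / N + h * (200 / (\<gamma>\<^sub>0 * T))"
  assumes "t \<le> T" "s \<le> N" "prob_weights X p" "prob_weights Y q"
  shows "\<exists>P. depth P \<le> t * (2 * (k + 1)) \<and>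
    err X Y f p q (deval P) \<le> F (real t) (real s) (pot p q)"
proof -
  have Tp: "0 < real T" using T by simp
  have Np: "0 < real N" using N(1) Tp by (smt (verit) mult_pos_pos exp_gt_zero)
  have trivial: "err X Y f p q G \<le> F (real t) (real s) (pot p q)"
    if "t \<le> T" "s \<le> N" "prob_weights X p" "prob_weights Y q"
      "t = 0 \<or> s = 0 \<or> \<gamma>\<^sub>0 * T / 100 \<le> pot p q \<or> err X Y f p q G \<le> 9/20"
    for p q t s G
  proof -
    have *: "(real T - t) / T \<ge> 0" "(real N - s) / N \<ge> 0" "pot p q * (200 / (\<gamma>\<^sub>0 * T)) \<ge> 0"
      using that pot_nonneg[of p q] gamma0_pos by auto
    note e1 = err_le_1[OF that(3,4), of f G]
    from that(5) show ?thesis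
    proof (elim disjE)
      assume "\<gamma>\<^sub>0 * T / 100 \<le> pot p q"
      then have "\<gamma>\<^sub>0 * T / 100 * (200 / (\<gamma>\<^sub>0 * T)) \<le> pot p q * (200 / (\<gamma>\<^sub>0 * T))"
        using gamma0_pos by (intro mult_right_mono) auto
      moreover have "\<gamma>\<^sub>0 * T / 100 * (200 / (\<gamma>\<^sub>0 * T)) = 2" using Tp gamma0_pos by simp
      ultimately have "1 \<le> pot p q * (200 / (\<gamma>\<^sub>0 * T))" by linarith
      then show ?thesis using * e1 unfolding F_def by linarith
    next
      assume "s = 0"
      then have "(real N - s) / N = 1" using Np by simp
      then show ?thesis using * e1 unfolding F_def by linarith
    next
      assume "t = 0"
      then have "(real T - t) / T = 1" using Tp by simp
      then show ?thesis using * e1 unfolding F_def by linarith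
    next
      assume "err X Y f p q G \<le> 9/20"
      then show ?thesis using * unfolding F_def by linarith
    qed
  qed
  show ?thesis
    using assms(5-)
  proof (induction t arbitrary: s p q)
    case 0
    then show ?case
      using trivial[of 0 s p q "\<lambda>_ _. True"] by (intro exI[of _ "Leaf True"]) auto
  next
    case (Suc t)
    let ?d = "t * (2 * (k + 1))"
    note IH = Suc.IH
    \<comment> \<open>Inner induction on the remaining questions: it lists the questions up to the
      next positive answer, with \<open>e\<close> run if there is none.\<close>
    have spine: "\<exists>qs e. length qs \<le> s \<and> (\<forall>t\<in>set qs. depth (snd (snd t)) \<le> ?d) \<and> depth e \<le> ?d
       \<and> err X Y f p q (run_spine qs e) \<le> F (real (Suc t)) (real s) (pot p q)"
      if "s \<le> N" "prob_weights X p" "prob_weights Y q" for s p q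
      using that
    proof (induction s arbitrary: p q)
      case 0
      show ?case using trivial[OF \<open>Suc t \<le> T\<close> 0] by (intro exI[of _ "[]"] exI[of _ "Leaf True"]) auto
    next
      case (Suc s)
      note p = Suc.prems(2) and q = Suc.prems(3)
      \<comment> \<open>At this potential the last term of \<open>F\<close> is 2, and
        \<open>100 * ?H\<close> is the exponent \<open>\<gamma>\<^sub>0 * T\<close> in the bound on
        \<open>N\<close>.\<close>
      let ?H = "\<gamma>\<^sub>0 * T / 100"
      show ?case
      proof (cases "?H \<le> pot p q \<or> err X Y f p q (\<lambda>_ _. True) \<le> 9/20 \<or> err X Y f p q (\<lambda>_ _. False) \<le> 9/20")
        case True
        then obtain z where "err X Y f p q (\<lambda>_ _. z) \<le> F (real (Suc t)) (real (Suc s)) (pot p q)"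
          using trivial[OF \<open>Suc t \<le> T\<close> Suc.prems(1) p q] by blast
        then show ?thesis by (intro exI[of _ "[]"] exI[of _ "Leaf z"]) auto
      next
        case False
        have "0 < ?H" using gamma0_pos Tp by simp
        have bal: "9/20 \<le> err X Y f p q (\<lambda>_ _. True)" "9/20 \<le> err X Y f p q (\<lambda>_ _. False)"
          and small: "pot p q \<le> ?H" using False by auto
        obtain g g' l p1 q1 p0 q0 where
          pq: "prob_weights X p1" "prob_weights X p0" "prob_weights Y q1" "prob_weights Y q0"
          and l: "0 < l" "l < 1" "exp (- 100 * ?H) \<le> l"
          and drop: "l * (\<gamma>\<^sub>0 / 100) \<le> pot p q - l * pot p1 q1 - (1 - l) * pot p0 q0"
          and er: "\<And>G G'. err X Y f p q (\<lambda>x y. if g x \<or> g' y then G x y else G' x y)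
            = l * err X Y f p1 q1 G + (1 - l) * err X Y f p0 q0 G'"
          by (rule exists_question_step[OF p q bal small \<open>0 < ?H\<close>]) blast
        have sN: "s \<le> N" using Suc.prems by simp
        have tT: "t \<le> T" using \<open>Suc t \<le> T\<close> by simp
        obtain P where P: "depth P \<le> ?d" "err X Y f p1 q1 (deval P) \<le> F (real t) (real s) (pot p1 q1)"
          using IH[OF tT sN pq(1,3)] by blast
        obtain qs e where qs: "length qs \<le> s" "\<forall>t\<in>set qs. depth (snd (snd t)) \<le> ?d" "depth e \<le> ?d"
          "err X Y f p0 q0 (run_spine qs e) \<le> F (real (Suc t)) (real s) (pot p0 q0)"
          using Suc.IH[OF sN pq(2,4)] by blast
        have "run_spine ((g, g', P) # qs) e = (\<lambda>x y. if g x \<or> g' y then deval P x y else run_spine qs e x y)"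
          by (intro ext) simp
        then have "err X Y f p q (run_spine ((g, g', P) # qs) e)
          = l * err X Y f p1 q1 (deval P) + (1 - l) * err X Y f p0 q0 (run_spine qs e)"
          by (simp add: er)
        also have "\<dots> \<le> l * F (real t) (real s) (pot p1 q1) + (1 - l) * F (real (Suc t)) (real s) (pot p0 q0)"
          using P qs l by (intro add_mono mult_left_mono) auto
        \<comment> \<open>A positive answer uses one unit of each budget, a negative one only a
          question, so on average \<open>l / T + 1 / N\<close> is spent.\<close>
        also have "\<dots> = F (real (Suc t)) (real (Suc s)) (pot p q) + l / T + 1 / N
            - (pot p q - l * pot p1 q1 - (1 - l) * pot p0 q0) * (200 / (\<gamma>\<^sub>0 * T))"
          using Tp Np unfolding F_def by (simp add: add_divide_distrib diff_divide_distrib algebra_simps)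
        also have "\<dots> \<le> F (real (Suc t)) (real (Suc s)) (pot p q)"
        proof -
          \<comment> \<open>The potential drop is worth \<open>l / T\<close> twice: once for the
            positive answer and once for the question, since \<open>1 / N\<close> is at most
            \<open>l / T\<close>.\<close>
          have "l * (\<gamma>\<^sub>0 / 100) * (200 / (\<gamma>\<^sub>0 * T)) \<le> (pot p q - l * pot p1 q1 - (1 - l) * pot p0 q0) * (200 / (\<gamma>\<^sub>0 * T))"
            using gamma0_pos by (intro mult_right_mono drop) auto
          moreover have "l * (\<gamma>\<^sub>0 / 100) * (200 / (\<gamma>\<^sub>0 * T)) = l / T + l / T"
            using gamma0_pos Tp by (simp add: field_simps)
          moreover have "1 / N \<le> l / T"
          proof -
            have "1 / N \<le> 1 / (real T * exp (\<gamma>\<^sub>0 * T))"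
              using N(1) Tp Np by (intro divide_left_mono) auto
            also have "\<dots> = exp (- 100 * ?H) / T" by (simp add: exp_minus field_simps)
            also have "\<dots> \<le> l / T" using l(3) by (intro divide_right_mono) auto
            finally show ?thesis .
          qed
          ultimately show ?thesis by linarith
        qed
        finally show ?thesis using P qs by (intro exI[of _ "(g, g', P) # qs"] exI[of _ e]) (auto simp del: run_spine.simps)
      qed
    qed
    obtain qs e where qs: "length qs \<le> s" "\<forall>t\<in>set qs. depth (snd (snd t)) \<le> ?d" "depth e \<le> ?d"
      "err X Y f p q (run_spine qs e) \<le> F (real (Suc t)) (real s) (pot p q)"
      using spine[OF Suc.prems(2-)] by blast
    have "length qs \<le> 2 ^ k" using qs(1) Suc.prems N(2) by linarith
    from spine_binary_search[OF this qs(2,3)] obtain P where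
      P: "depth P \<le> 2 * (k + 1) + ?d" "\<And>x y. deval P x y = run_spine qs e x y" by blast
    have "deval P = run_spine qs e" by (intro ext P)
    then show ?case using P(1) qs(4) by (intro exI[of _ P]) simp
  qed
qed

end

section \<open>Choice of parameters and quadratic communication\<close>

definition cc_const :: real where
  "cc_const = 2 * (4 + \<gamma>\<^sub>0 / ln 2) * (5000 / \<gamma>\<^sub>0 + 2)\<^sup>2"

text \<open>\<open>T\<close> makes the potential term at most 200/5000 = 1/25, the difference of
  49/100 and 9/20; the budget terms vanish at the start. Since \<open>k\<close> is linear in
  \<open>T\<close> and \<open>T\<close> is linear in \<open>1 + h\<close>, the depth is quadratic;
  \<open>cc_const\<close> collects the factors.\<close>

lemma (in rectangle_cover) exists_protocol_quadratic:
  assumes p: "prob_weights X p" and q: "prob_weights Y q"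
  shows "\<exists>P. real (depth P) \<le> cc_const * (1 + pot p q)\<^sup>2 \<and> err X Y f p q (deval P) \<le> 49/100"
proof -
  define h where "h = pot p q"
  define T where "T = nat \<lceil>5000 * h / \<gamma>\<^sub>0\<rceil> + 1"
  define N where "N = nat \<lceil>real T * exp (\<gamma>\<^sub>0 * T)\<rceil>"
  define m where "m = nat \<lceil>\<gamma>\<^sub>0 / ln 2\<rceil>"
  \<comment> \<open>\<open>T\<close> bits for the factor \<open>T\<close>, \<open>m * T\<close> for
    the exponential, and one for rounding \<open>N\<close> up.\<close>
  define k where "k = 1 + T + m * T"
  have h: "0 \<le> h" using pot_nonneg[OF p q] by (simp add: h_def)
  have T0: "0 < T" by (simp add: T_def)
  have Tlo: "5000 * h / \<gamma>\<^sub>0 \<le> T" unfolding T_def by linarith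
  have hg: "0 \<le> 5000 * h / \<gamma>\<^sub>0" using h gamma0_pos by simp
  have "real T \<le> 5000 * h / \<gamma>\<^sub>0 + 2" unfolding T_def using hg by linarith
  also have "\<dots> \<le> (5000 / \<gamma>\<^sub>0 + 2) * (1 + h)" using h gamma0_pos by (simp add: field_simps)
  finally have Thi: "real T \<le> (5000 / \<gamma>\<^sub>0 + 2) * (1 + h)" .
  have N1: "real T * exp (\<gamma>\<^sub>0 * T) \<le> N" unfolding N_def by linarith
  have "\<gamma>\<^sub>0 / ln 2 \<le> m" unfolding m_def by linarith
  then have "\<gamma>\<^sub>0 * T \<le> (m * ln 2) * T"
    by (intro mult_right_mono) (auto simp: field_simps)
  also have "\<dots> = ln (2 ^ (m * T))" by (simp add: ln_realpow)
  finally have ex: "exp (\<gamma>\<^sub>0 * T) \<le> 2 ^ (m * T)" by (subst (asm) ln_ge_iff) auto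
  have "real T \<le> 2 ^ T" using of_nat_less_two_power[of T, where 'a = real] by simp
  then have prod: "real T * exp (\<gamma>\<^sub>0 * T) \<le> 2 ^ T * 2 ^ (m * T)" using ex by (intro mult_mono) auto
  have "0 \<le> real T * exp (\<gamma>\<^sub>0 * T)" by simp
  then have "real N \<le> real T * exp (\<gamma>\<^sub>0 * T) + 1" unfolding N_def by linarith
  also have "\<dots> \<le> 2 ^ T * 2 ^ (m * T) + 2 ^ T * 2 ^ (m * T)"
    using prod one_le_power[of "2::real" "T + m * T"] by (intro add_mono) (auto simp: power_add)
  also have "\<dots> = 2 ^ k" by (simp add: k_def power_add)
  finally have N2: "N \<le> 2 ^ k" by (metis of_nat_le_iff of_nat_numeral of_nat_power)
  obtain P where P: "depth P \<le> T * (2 * (k + 1))"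
    "err X Y f p q (deval P) \<le> 9/20 + (real T - real T) / T + (real N - real N) / N + h * (200 / (\<gamma>\<^sub>0 * T))"
    using exists_protocol_bounded_questions[OF T0 N1 N2 order_refl order_refl p q] unfolding h_def by blast
  have "h * (200 / (\<gamma>\<^sub>0 * T)) \<le> 1/25" using Tlo T0 gamma0_pos by (simp add: field_simps)
  then have e: "err X Y f p q (deval P) \<le> 49/100" using P(2) by simp
  have m: "real m \<le> \<gamma>\<^sub>0 / ln 2 + 1" unfolding m_def using gamma0_pos by simp
  have T1: "1 \<le> real T" using T0 by simp
  have "real (k + 1) \<le> (3 + real m) * T"
    using T1 by (simp add: k_def algebra_simps)
  also have "\<dots> \<le> (4 + \<gamma>\<^sub>0 / ln 2) * T" using m by (intro mult_right_mono) auto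
  finally have k: "real (k + 1) \<le> (4 + \<gamma>\<^sub>0 / ln 2) * T" .
  have "real (depth P) \<le> real (T * (2 * (k + 1)))" using P(1) by (simp only: of_nat_le_iff)
  also have "\<dots> = 2 * (real T * real (k + 1))" by (simp add: algebra_simps)
  also have "\<dots> \<le> 2 * (real T * ((4 + \<gamma>\<^sub>0 / ln 2) * T))" using k by (intro mult_left_mono) auto
  also have "\<dots> = 2 * (4 + \<gamma>\<^sub>0 / ln 2) * (real T)\<^sup>2" by (simp add: power2_eq_square)
  also have "\<dots> \<le> 2 * (4 + \<gamma>\<^sub>0 / ln 2) * ((5000 / \<gamma>\<^sub>0 + 2) * (1 + h))\<^sup>2"
    using Thi gamma0_pos by (intro mult_left_mono power_mono) auto
  also have "\<dots> = cc_const * (1 + h)\<^sup>2" by (simp add: cc_const_def power_mult_distrib)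
  finally show ?thesis using e unfolding h_def by blast
qed

lemma cc_const_pos: "cc_const > 0"
  unfolding cc_const_def using gamma0_pos
  by (intro mult_pos_pos zero_less_power add_pos_pos divide_pos_pos) auto

section \<open>An approximate minimax principle\<close>

text \<open>A short step from \<open>e\<close> towards the best response to the weights \<open>max 0 (e s - c)\<close> decreases
  the sum of the squares of these weights.\<close>

lemma approx_minimax:
  fixes K :: "('s \<Rightarrow> real) set"
  assumes fin: "finite S" "S \<noteq> {}" and c: "0 \<le> c" and \<gamma>: "0 < \<gamma>"
    and conv: "\<And>e e' t. e \<in> K \<Longrightarrow> e' \<in> K \<Longrightarrow> 0 \<le> t \<Longrightarrow> t \<le> 1 \<Longrightarrow> (\<lambda>s. (1 - t) * e s + t * e' s) \<in> K"
    and bnd: "\<And>e s. e \<in> K \<Longrightarrow> s \<in> S \<Longrightarrow> 0 \<le> e s \<and> e s \<le> 1"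
    and resp: "\<And>\<nu>. prob_weights S \<nu> \<Longrightarrow> \<exists>e\<in>K. (\<Sum>s\<in>S. \<nu> s * e s) \<le> c"
  shows "\<exists>e\<in>K. \<forall>s\<in>S. e s \<le> c + \<gamma>"
proof (rule ccontr)
  assume neg: "\<not> ?thesis"
  define m where "m e s = max 0 (e s - c)" for e and s :: 's
  define \<phi> where "\<phi> e = (\<Sum>s\<in>S. (m e s)\<^sup>2)" for e
  define M where "M = real (card S)"
  have M: "0 < M" using fin by (simp add: M_def card_gt_0_iff)
  have \<phi>_ge: "\<gamma>\<^sup>2 \<le> \<phi> e" if e: "e \<in> K" for e
  proof -
    obtain s where s: "s \<in> S" "c + \<gamma> < e s" using neg e by force
    have "\<gamma>\<^sup>2 \<le> (m e s)\<^sup>2" using s \<gamma> by (intro power_mono) (auto simp: m_def)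
    also have "\<dots> \<le> \<phi> e" unfolding \<phi>_def using s fin by (intro member_le_sum) auto
    finally show ?thesis .
  qed
  have \<phi>_le: "\<phi> e \<le> M" if e: "e \<in> K" for e
  proof -
    have "\<phi> e \<le> (\<Sum>s\<in>S. 1)"
      unfolding \<phi>_def using bnd[OF e] c by (intro sum_mono power_le_one) (force simp: m_def)+
    then show ?thesis by (simp add: M_def)
  qed
  obtain s0 where s0: "s0 \<in> S" using fin by blast
  have "prob_weights S (\<lambda>s. of_bool (s = s0))" using s0 fin by (simp add: prob_weights_def of_bool_def)
  from resp[OF this] obtain e0 where e0: "e0 \<in> K" by blast
  \<comment> \<open>If no point of \<open>K\<close> is uniformly good, \<open>L\<close> is positive;
    a step from a near-minimiser will fall below it.\<close>
  define L where "L = Inf (\<phi> ` K)"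
  have bb: "bdd_below (\<phi> ` K)" using \<phi>_ge by (auto intro!: bdd_belowI2)
  have L: "\<gamma>\<^sup>2 \<le> L" unfolding L_def using e0 \<phi>_ge by (intro cInf_greatest) auto
  have L_le: "L \<le> \<phi> e" if "e \<in> K" for e unfolding L_def using bb that by (intro cInf_lower) auto
  have L0: "0 < L" using L \<gamma> by (meson less_le_trans zero_less_power)
  \<comment> \<open>This step length makes the second-order term \<open>t\<^sup>2 * M\<close> equal
    to \<open>t * L / 2\<close>, less than the first-order gain of at least
    \<open>2 * t * L\<close>.\<close>
  define t where "t = L / (2 * M)"
  have LM: "L \<le> M" using L_le[OF e0] \<phi>_le[OF e0] by simp
  have t: "0 < t" "t \<le> 1" "t * M = L / 2" using L0 LM M by (auto simp: t_def field_simps)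
  have "Inf (\<phi> ` K) < L + t * L" using t L0 by (simp add: L_def)
  then obtain e where e: "e \<in> K" "\<phi> e < L + t * L"
    using cInf_lessD[of "\<phi> ` K"] e0 by blast
  define Z where "Z = (\<Sum>s\<in>S. m e s)"
  have m0: "0 \<le> m e s" for s by (simp add: m_def)
  have Z: "0 < Z"
  proof -
    obtain s where "s \<in> S" "c + \<gamma> < e s" using neg e by force
    then show ?thesis unfolding Z_def using fin m0 \<gamma> by (intro sum_pos2[of S s]) (auto simp: m_def)
  qed
  have "prob_weights S (\<lambda>s. m e s / Z)"
    using Z m0 by (auto simp: prob_weights_def Z_def simp flip: sum_divide_distrib)
  from resp[OF this] obtain e' where e': "e' \<in> K" "(\<Sum>s\<in>S. m e s / Z * e' s) \<le> c" by blast
  have "(\<Sum>s\<in>S. m e s * e' s) / Z \<le> c" using e'(2) by (simp add: sum_divide_distrib)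
  then have me': "(\<Sum>s\<in>S. m e s * e' s) \<le> c * Z" using Z by (simp add: divide_le_eq)
  \<comment> \<open>\<open>m e s\<close> vanishes unless \<open>e s\<close> exceeds
    \<open>c\<close>, and then \<open>e s = c + m e s\<close>.\<close>
  have "(\<Sum>s\<in>S. m e s * e s) = (\<Sum>s\<in>S. m e s * c + (m e s)\<^sup>2)"
    by (intro sum.cong refl) (auto simp: m_def max_def power2_eq_square algebra_simps)
  also have "\<dots> = c * Z + \<phi> e" by (simp add: sum.distrib Z_def \<phi>_def sum_distrib_left mult.commute)
  finally have md: "(\<Sum>s\<in>S. m e s * (e' s - e s)) \<le> - \<phi> e"
    using me' by (simp add: right_diff_distrib sum_subtractf)
  let ?e = "\<lambda>s. (1 - t) * e s + t * e' s"
  have "\<phi> ?e \<le> (\<Sum>s\<in>S. (m e s)\<^sup>2 + 2 * t * (m e s * (e' s - e s)) + t\<^sup>2)"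
    unfolding \<phi>_def
  proof (rule sum_mono)
    fix s assume s: "s \<in> S"
    let ?d = "e' s - e s"
    have "(m ?e s)\<^sup>2 \<le> (m e s + t * ?d)\<^sup>2"
    proof (cases "?e s - c \<le> 0")
      case True then show ?thesis by (simp add: m_def)
    next
      case False
      then have "m ?e s = ?e s - c" by (simp add: m_def)
      also have "\<dots> \<le> m e s + t * ?d" by (simp add: m_def algebra_simps)
      finally show ?thesis by (intro power_mono) (auto simp: m_def)
    qed
    also have "\<dots> = (m e s)\<^sup>2 + 2 * t * (m e s * ?d) + t\<^sup>2 * ?d\<^sup>2"
      by (simp add: power2_eq_square algebra_simps)
    also have "t\<^sup>2 * ?d\<^sup>2 \<le> t\<^sup>2 * 1"
    proof (rule mult_left_mono)
      have "\<bar>?d\<bar> \<le> 1" using bnd[OF e(1) s] bnd[OF e'(1) s] by linarith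
      then show "?d\<^sup>2 \<le> 1" by (simp add: abs_square_le_1)
    qed simp
    finally show "(m ?e s)\<^sup>2 \<le> (m e s)\<^sup>2 + 2 * t * (m e s * ?d) + t\<^sup>2" by simp
  qed
  also have "\<dots> = \<phi> e + 2 * t * (\<Sum>s\<in>S. m e s * (e' s - e s)) + t\<^sup>2 * M"
    by (simp add: sum.distrib \<phi>_def M_def sum_distrib_left)
  also have "\<dots> \<le> \<phi> e + 2 * t * (- \<phi> e) + t\<^sup>2 * M"
    using md t by (intro add_mono mult_left_mono) auto
  also have "t\<^sup>2 * M = t * (L / 2)" using t(3) by (simp add: power2_eq_square)
  also have "\<phi> e + 2 * t * (- \<phi> e) + t * (L / 2) \<le> \<phi> e + 2 * t * (- L) + t * (L / 2)"
    using t L_le[OF e(1)] by (intro add_mono mult_left_mono) auto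
  \<comment> \<open>Near-minimality adds less than \<open>t * L\<close>, so the change relative to
    \<open>L\<close> is below \<open>1 - 2 + 1/2\<close> times \<open>t * L\<close>.\<close>
  also have "\<dots> < L" using e(2) mult_pos_pos[OF t(1) L0] by (simp add: algebra_simps)
  finally have "\<phi> ?e < L" .
  moreover have "?e \<in> K" using t by (intro conv e e') auto
  ultimately show False using L_le[of ?e] by simp
qed

section \<open>Information cost of protocols\<close>

text \<open>Both sums are unnormalised entropies of the message \<open>\<sigma>\<close>. As the
  logarithms on the right are nonnegative, \<open>\<kappa>\<close> may be lowered to
  \<open>\<eta> * r\<close> in front of them; by Gibbs' inequality, coding \<open>r\<close> with the
  message probabilities of \<open>\<kappa>\<close> costs at least the entropy under
  \<open>r\<close>.\<close>

lemma cross_entropy_ge: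
  fixes \<kappa> r :: "'a \<Rightarrow> real" and \<sigma> :: "'a \<Rightarrow> 't"
  assumes fin: "finite X" and r: "\<And>a. a \<in> X \<Longrightarrow> 0 \<le> r a" and \<kappa>0: "\<And>a. a \<in> X \<Longrightarrow> 0 \<le> \<kappa> a"
    and \<kappa>: "\<And>a. a \<in> X \<Longrightarrow> \<eta> * r a \<le> \<kappa> a" and \<eta>: "0 < \<eta>"
  shows "\<eta> * (\<Sum>a\<in>X. r a * ln ((\<Sum>b\<in>X. r b) / (\<Sum>b\<in>X. r b * of_bool (\<sigma> b = \<sigma> a))))
    \<le> (\<Sum>a\<in>X. \<kappa> a * ln ((\<Sum>b\<in>X. \<kappa> b) / (\<Sum>b\<in>X. \<kappa> b * of_bool (\<sigma> b = \<sigma> a))))"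
proof -
  define U U0 where "U = (\<Sum>b\<in>X. \<kappa> b)" and "U0 = (\<Sum>b\<in>X. r b)"
  define S S0 where "S a = (\<Sum>b\<in>X. \<kappa> b * of_bool (\<sigma> b = \<sigma> a))"
    and "S0 a = (\<Sum>b\<in>X. r b * of_bool (\<sigma> b = \<sigma> a))" for a
  have S: "0 \<le> S a" "S a \<le> U" for a
    unfolding S_def U_def using \<kappa>0 by (auto intro!: sum_nonneg sum_mono)
  have S0: "0 \<le> S0 a" for a unfolding S0_def using r by (auto intro!: sum_nonneg)
  have Sge: "\<kappa> a \<le> S a" if "a \<in> X" for a
  proof -
    have "\<kappa> a * of_bool (\<sigma> a = \<sigma> a) \<le> S a" unfolding S_def
      by (rule member_le_sum[of a X "\<lambda>b. \<kappa> b * of_bool (\<sigma> b = \<sigma> a)"]) (use that \<kappa>0 fin in auto)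
    then show ?thesis by simp
  qed
  have S0ge: "r a \<le> S0 a" if "a \<in> X" for a
  proof -
    have "r a * of_bool (\<sigma> a = \<sigma> a) \<le> S0 a" unfolding S0_def
      by (rule member_le_sum[of a X "\<lambda>b. r b * of_bool (\<sigma> b = \<sigma> a)"]) (use that r fin in auto)
    then show ?thesis by simp
  qed
  have U0ge: "r a \<le> U0" if "a \<in> X" for a
    unfolding U0_def by (rule member_le_sum) (use that r fin in auto)
  have lnn: "0 \<le> ln (U / S a)" for a
    using S[of a] by (cases "S a = 0") auto
  have "(\<Sum>a\<in>X. r a * (ln (U0 / S0 a) - ln (U / S a))) \<le> (\<Sum>a\<in>X. U0 / U * (r a * S a / S0 a) - r a)"
  proof (rule sum_mono)
    fix a assume a: "a \<in> X"
    show "r a * (ln (U0 / S0 a) - ln (U / S a)) \<le> U0 / U * (r a * S a / S0 a) - r a"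
    proof (cases "r a = 0")
      case False
      then have ra: "0 < r a" using r[OF a] by simp
      have pos: "0 < S0 a" "0 < U0" using S0ge[OF a] U0ge[OF a] ra by auto
      have "0 < \<eta> * r a" using \<eta> ra by simp
      then have pos': "0 < S a" "0 < U" using Sge[OF a] \<kappa>[OF a] S[of a] by linarith+
      have "ln (U0 / S0 a) - ln (U / S a) = ln (U0 * S a / (S0 a * U))"
        using pos pos' by (simp add: ln_div ln_mult)
      also have "\<dots> \<le> U0 * S a / (S0 a * U) - 1" using pos pos' by (intro ln_le_minus_one) auto
      finally have "r a * (ln (U0 / S0 a) - ln (U / S a)) \<le> r a * (U0 * S a / (S0 a * U) - 1)"
        using ra by (intro mult_left_mono) auto
      then show ?thesis by (simp add: field_simps)
    qed simp
  qed
  also have "\<dots> = U0 / U * (\<Sum>a\<in>X. r a * S a / S0 a) - U0"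
    by (simp add: sum_subtractf sum_distrib_left U0_def)
  also have "\<dots> \<le> U0 / U * U - U0"
  proof -
    \<comment> \<open>Summing \<open>r\<close> over the class of \<open>b\<close> gives
      \<open>S0 b\<close>, so the quotient is 1, or 0 if the class has no mass under
      \<open>r\<close>.\<close>
    have "(\<Sum>a\<in>X. r a * S a / S0 a) = (\<Sum>a\<in>X. \<Sum>b\<in>X. \<kappa> b * (r a * of_bool (\<sigma> a = \<sigma> b) / S0 b))"
      unfolding S_def sum_distrib_left sum_divide_distrib
      by (intro sum.cong refl) (auto simp: S0_def)
    also have "\<dots> = (\<Sum>b\<in>X. \<Sum>a\<in>X. \<kappa> b * (r a * of_bool (\<sigma> a = \<sigma> b) / S0 b))"
      by (rule sum.swap)
    also have "\<dots> = (\<Sum>b\<in>X. \<kappa> b * (S0 b / S0 b))"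
      unfolding sum_distrib_left[symmetric] sum_divide_distrib[symmetric] S0_def ..
    also have "\<dots> \<le> U" unfolding U_def using \<kappa>0 by (intro sum_mono) auto
    finally show ?thesis
      using r \<kappa>0 by (intro diff_right_mono mult_left_mono) (auto simp: U0_def U_def intro!: divide_nonneg_nonneg sum_nonneg)
  qed
  also have "\<dots> \<le> 0" using r by (cases "U = 0") (auto simp: U0_def intro!: sum_nonneg)
  finally have "(\<Sum>a\<in>X. r a * ln (U0 / S0 a)) \<le> (\<Sum>a\<in>X. r a * ln (U / S a))"
    by (simp add: right_diff_distrib sum_subtractf)
  then have "\<eta> * (\<Sum>a\<in>X. r a * ln (U0 / S0 a)) \<le> \<eta> * (\<Sum>a\<in>X. r a * ln (U / S a))"
    using \<eta> by (intro mult_left_mono) auto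
  also have "\<dots> = (\<Sum>a\<in>X. \<eta> * r a * ln (U / S a))" by (simp add: sum_distrib_left mult.assoc)
  also have "\<dots> \<le> (\<Sum>a\<in>X. \<kappa> a * ln (U / S a))"
    using \<kappa> lnn by (intro sum_mono mult_right_mono) auto
  finally show ?thesis unfolding U_def U0_def S_def S0_def .
qed

section \<open>Finite sums for pmfs and error probabilities\<close>

lemma prob_eq_sum:
  assumes "finite S" "set_pmf M \<subseteq> S"
  shows "measure_pmf.prob M E = (\<Sum>z\<in>S. pmf M z * of_bool (z \<in> E))"
proof -
  have "measure_pmf.prob M E = measure_pmf.prob M (E \<inter> S)"
    using assms by (metis (no_types, lifting) Int_absorb1 inf_assoc inf_commute measure_Int_set_pmf)
  also have "\<dots> = sum (pmf M) (E \<inter> S)" using assms by (intro measure_measure_pmf_finite) auto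
  also have "\<dots> = (\<Sum>z\<in>S. pmf M z * of_bool (z \<in> E))"
    using assms by (intro sum.mono_neutral_cong_left) auto
  finally show ?thesis .
qed

lemma prob_weights_pmf: "finite S \<Longrightarrow> set_pmf M \<subseteq> S \<Longrightarrow> prob_weights S (pmf M)"
  by (auto simp: prob_weights_def sum_pmf_eq_1)

lemma finite_cube: "finite (cube n)"
proof -
  have "cube n = {xs. set xs \<subseteq> UNIV \<and> length xs = n}" by (auto simp: cube_def)
  then show ?thesis using finite_lists_length_eq[of "UNIV :: bool set" n] by simp
qed

lemma det_err_eq_err:
  assumes "set_pmf p \<subseteq> cube n" "set_pmf q \<subseteq> cube n"
  shows "det_err (pair_pmf p q) f P = err (cube n) (cube n) f (pmf p) (pmf q) (deval P)"
proof -
  have "det_err (pair_pmf p q) f P =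
      (\<Sum>z\<in>cube n \<times> cube n. pmf (pair_pmf p q) z * of_bool (z \<in> {(x, y). deval P x y \<noteq> f x y}))"
    unfolding det_err_def using assms finite_cube by (intro prob_eq_sum) auto
  also have "\<dots> = err (cube n) (cube n) f (pmf p) (pmf q) (deval P)"
    unfolding err_def sum.cartesian_product by (intro sum.cong refl) (auto simp: pmf_pair)
  finally show ?thesis .
qed

lemma CC_dist_le: "det_err \<mu> f P \<le> \<epsilon> \<Longrightarrow> CC_dist \<mu> \<epsilon> f \<le> depth P"
  unfolding CC_dist_def by (intro Least_le) auto

text \<open>The protocol is independent of the inputs, so its probability cancels; the bits are a
  function of protocol and inputs. What remains is the entropy of the bits given \<open>c\<close>,
  averaged over protocols. \<open>tr\<close> is abstract so that either player can be the one who is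
  observed.\<close>

lemma cmi_transcript:
  fixes K :: "('a::countable \<times> 'c::countable) pmf" and RP :: "'p pmf" and tr :: "'p \<Rightarrow> 'a \<Rightarrow> 'c \<Rightarrow> 't"
  assumes X: "finite X" and Y: "finite Y" and K: "set_pmf K \<subseteq> X \<times> Y" and RP: "finite (set_pmf RP)"
  shows "cmi (map_pmf (\<lambda>((a, c), P). (a, (P, tr P a c), c)) (pair_pmf K RP)) =
    (\<Sum>P\<in>set_pmf RP. pmf RP P * (\<Sum>c\<in>Y. \<Sum>a\<in>X. pmf K (a, c) *
      ln ((\<Sum>b\<in>X. pmf K (b, c)) / (\<Sum>b\<in>X. pmf K (b, c) * of_bool (tr P b c = tr P a c))))) / ln 2"
proof -
  let ?h = "\<lambda>((a, c), P). (a, (P, tr P a c), c)"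
  define J where "J = map_pmf ?h (pair_pmf K RP)"
  have inj: "inj ?h" by (auto simp: inj_def)
  have m_c: "pmf (map_pmf (\<lambda>(a, b, c). c) J) c = (\<Sum>b\<in>X. pmf K (b, c))" if "c \<in> Y" for c
  proof -
    have "map_pmf (\<lambda>(a, b, c). c) J = map_pmf snd (map_pmf fst (pair_pmf K RP))"
      unfolding J_def pmf.map_comp by (intro map_pmf_cong) (auto simp: o_def)
    also have "\<dots> = map_pmf snd K" by (simp add: map_fst_pair_pmf)
    finally have "pmf (map_pmf (\<lambda>(a, b, c). c) J) c = measure_pmf.prob K (snd -` {c})" by (simp add: pmf_map)
    also have "\<dots> = (\<Sum>z\<in>X \<times> Y. pmf K z * of_bool (z \<in> snd -` {c}))" using X Y K by (intro prob_eq_sum) auto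
    also have "\<dots> = (\<Sum>b\<in>X. \<Sum>d\<in>Y. if d = c then pmf K (b, d) else 0)"
      unfolding sum.cartesian_product by (intro sum.cong) auto
    also have "\<dots> = (\<Sum>b\<in>X. pmf K (b, c))" using that Y by simp
    finally show ?thesis .
  qed
  have m_ac: "pmf (map_pmf (\<lambda>(a, b, c). (a, c)) J) ac = pmf K ac" for ac
  proof -
    have "map_pmf (\<lambda>(a, b, c). (a, c)) J = map_pmf fst (pair_pmf K RP)"
      unfolding J_def pmf.map_comp by (intro map_pmf_cong) (auto simp: o_def)
    then show ?thesis by (simp add: map_fst_pair_pmf)
  qed
  have m_bc: "pmf (map_pmf (\<lambda>(a, b, c). (b, c)) J) ((P, tr P a c), c)
      = pmf RP P * (\<Sum>b\<in>X. pmf K (b, c) * of_bool (tr P b c = tr P a c))" if "c \<in> Y" for P a c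
  proof -
    have "map_pmf (\<lambda>(a, b, c). (b, c)) J = map_pmf (\<lambda>((a, c), P). ((P, tr P a c), c)) (pair_pmf K RP)"
      unfolding J_def pmf.map_comp by (intro map_pmf_cong) (auto simp: o_def)
    then have "pmf (map_pmf (\<lambda>(a, b, c). (b, c)) J) ((P, tr P a c), c)
      = measure_pmf.prob (pair_pmf K RP) ((\<lambda>((a, c), P). ((P, tr P a c), c)) -` {((P, tr P a c), c)})"
      by (simp add: pmf_map)
    also have "(\<lambda>((a, c), P). ((P, tr P a c), c)) -` {((P, tr P a c), c)} = {(b, d). d = c \<and> tr P b c = tr P a c} \<times> {P}"
      by auto
    also have "measure_pmf.prob (pair_pmf K RP) \<dots> = measure_pmf.prob K {(b, d). d = c \<and> tr P b c = tr P a c} * pmf RP P"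
      by (subst measure_pmf_prob_product) (auto simp: measure_pmf_single)
    also have "measure_pmf.prob K {(b, d). d = c \<and> tr P b c = tr P a c}
      = (\<Sum>z\<in>X \<times> Y. pmf K z * of_bool (z \<in> {(b, d). d = c \<and> tr P b c = tr P a c}))" using X Y K by (intro prob_eq_sum) auto
    also have "\<dots> = (\<Sum>b\<in>X. \<Sum>d\<in>Y. if d = c then pmf K (b, d) * of_bool (tr P b c = tr P a c) else 0)"
      unfolding sum.cartesian_product by (intro sum.cong) (auto split: if_splits)
    also have "\<dots> = (\<Sum>b\<in>X. pmf K (b, c) * of_bool (tr P b c = tr P a c))" using that Y by simp
    also have "\<dots> * pmf RP P = pmf RP P * \<dots>" by (rule mult.commute)
    finally show ?thesis .
  qed
  define G where "G = (\<lambda>(a, b, c). pmf J (a, b, c) * log 2 ((pmf J (a, b, c) * pmf (map_pmf (\<lambda>(a, b, c). c) J) c) /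
    (pmf (map_pmf (\<lambda>(a, b, c). (a, c)) J) (a, c) * pmf (map_pmf (\<lambda>(a, b, c). (b, c)) J) (b, c))))"
  have "set_pmf J = ?h ` (set_pmf K \<times> set_pmf RP)" by (simp add: J_def)
  then have "cmi J = (\<Sum>t\<in>?h ` (set_pmf K \<times> set_pmf RP). G t)"
    unfolding cmi_def G_def by (simp only:)
  also have "\<dots> = (\<Sum>t\<in>set_pmf K \<times> set_pmf RP. G (?h t))"
    by (subst sum.reindex) (auto intro: inj_on_subset[OF inj] simp only: o_def subset_UNIV)
  also have "\<dots> = (\<Sum>((a, c), P)\<in>set_pmf K \<times> set_pmf RP. pmf RP P * (pmf K (a, c) *
      log 2 ((\<Sum>b\<in>X. pmf K (b, c)) / (\<Sum>b\<in>X. pmf K (b, c) * of_bool (tr P b c = tr P a c)))))"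
  proof (intro sum.cong refl, clarify)
    fix a c P assume acP: "(a, c) \<in> set_pmf K" "P \<in> set_pmf RP"
    have J: "pmf J (a, (P, tr P a c), c) = pmf K (a, c) * pmf RP P"
      using pmf_map_inj'[OF inj, of "pair_pmf K RP" "((a, c), P)"] by (simp add: pmf_pair J_def)
    have c: "c \<in> Y" using acP K by auto
    have pos: "pmf K (a, c) \<noteq> 0" "pmf RP P \<noteq> 0" using acP by (auto simp: set_pmf_iff)
    show "G (a, (P, tr P a c), c) = pmf RP P * (pmf K (a, c) *
      log 2 ((\<Sum>b\<in>X. pmf K (b, c)) / (\<Sum>b\<in>X. pmf K (b, c) * of_bool (tr P b c = tr P a c))))"
      unfolding G_def prod.case J m_c[OF c] m_ac m_bc[OF c] using pos by simp
  qed
  also have "\<dots> = (\<Sum>(a, c)\<in>set_pmf K. \<Sum>P\<in>set_pmf RP. pmf RP P * (pmf K (a, c) *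
      log 2 ((\<Sum>b\<in>X. pmf K (b, c)) / (\<Sum>b\<in>X. pmf K (b, c) * of_bool (tr P b c = tr P a c)))))"
    by (subst sum.cartesian_product[symmetric]) (simp add: case_prod_unfold)
  also have "\<dots> = (\<Sum>(a, c)\<in>X \<times> Y. \<Sum>P\<in>set_pmf RP. pmf RP P * (pmf K (a, c) *
      log 2 ((\<Sum>b\<in>X. pmf K (b, c)) / (\<Sum>b\<in>X. pmf K (b, c) * of_bool (tr P b c = tr P a c)))))"
    using X Y K by (intro sum.mono_neutral_left) (auto simp: set_pmf_iff)
  also have "\<dots> = (\<Sum>P\<in>set_pmf RP. \<Sum>(a, c)\<in>X \<times> Y. pmf RP P * (pmf K (a, c) *
      log 2 ((\<Sum>b\<in>X. pmf K (b, c)) / (\<Sum>b\<in>X. pmf K (b, c) * of_bool (tr P b c = tr P a c)))))"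
    by (simp only: case_prod_unfold, rule sum.swap)
  also have "\<dots> = (\<Sum>P\<in>set_pmf RP. pmf RP P * (\<Sum>a\<in>X. \<Sum>c\<in>Y. pmf K (a, c) *
      ln ((\<Sum>b\<in>X. pmf K (b, c)) / (\<Sum>b\<in>X. pmf K (b, c) * of_bool (tr P b c = tr P a c))))) / ln 2"
    by (simp add: sum.cartesian_product case_prod_unfold sum_distrib_left sum_divide_distrib log_def)
  also have "\<dots> = (\<Sum>P\<in>set_pmf RP. pmf RP P * (\<Sum>c\<in>Y. \<Sum>a\<in>X. pmf K (a, c) *
      ln ((\<Sum>b\<in>X. pmf K (b, c)) / (\<Sum>b\<in>X. pmf K (b, c) * of_bool (tr P b c = tr P a c))))) / ln 2"
    by (subst sum.swap) simp
  finally show ?thesis unfolding J_def .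
qed

text \<open>In each column \<open>c\<close>, \<open>cross_entropy_ge\<close> is used with
  \<open>r a = p a * q c\<close>. Conditioning product weights on \<open>c\<close> leaves
  \<open>p\<close>, so the entropies become logarithms of \<open>mass\<close>.\<close>

lemma cmi_transcript_ge:
  fixes K :: "('a::countable \<times> 'c::countable) pmf" and RP :: "'p pmf" and tr :: "'p \<Rightarrow> 'a \<Rightarrow> 'c \<Rightarrow> 't"
  assumes X: "finite X" and Y: "finite Y" and K: "set_pmf K \<subseteq> X \<times> Y" and RP: "finite (set_pmf RP)"
    and p: "prob_weights X p" and q: "prob_weights Y q" and \<eta>: "0 < \<eta>"
    and dom: "\<And>a c. a \<in> X \<Longrightarrow> c \<in> Y \<Longrightarrow> \<eta> * (p a * q c) \<le> pmf K (a, c)"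
  shows "\<eta> / ln 2 * (\<Sum>P\<in>set_pmf RP. pmf RP P * (\<Sum>c\<in>Y. \<Sum>a\<in>X. p a * q c *
      (- ln (mass X p {b. tr P b c = tr P a c}))))
    \<le> cmi (map_pmf (\<lambda>((a, c), P). (a, (P, tr P a c), c)) (pair_pmf K RP))"
proof -
  have p0: "0 \<le> p a" if "a \<in> X" for a using p that by (simp add: prob_weights_def)
  have q0: "0 \<le> q c" if "c \<in> Y" for c using q that by (simp add: prob_weights_def)
  have main: "\<eta> * (\<Sum>a\<in>X. p a * q c * (- ln (mass X p {b. tr P b c = tr P a c})))
      \<le> (\<Sum>a\<in>X. pmf K (a, c) *
      ln ((\<Sum>b\<in>X. pmf K (b, c)) / (\<Sum>b\<in>X. pmf K (b, c) * of_bool (tr P b c = tr P a c))))"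
    (is "?L \<le> ?R") if c: "c \<in> Y" for P c
  proof -
    have "?L = \<eta> * (\<Sum>a\<in>X. p a * q c *
      ln ((\<Sum>b\<in>X. p b * q c) / (\<Sum>b\<in>X. p b * q c * of_bool (tr P b c = tr P a c))))"
    proof (rule arg_cong[where f = "(*) \<eta>"], rule sum.cong[OF refl])
      fix a assume a: "a \<in> X"
      have s1: "(\<Sum>b\<in>X. p b * q c) = q c"
        using p by (simp add: prob_weights_def flip: sum_distrib_right)
      have s2: "(\<Sum>b\<in>X. p b * q c * of_bool (tr P b c = tr P a c)) = q c * mass X p {b. tr P b c = tr P a c}"
        by (simp add: mass_def sum_distrib_left mult_ac)
      have "p a * q c * ln (q c / (q c * mass X p {b. tr P b c = tr P a c}))
        = p a * q c * (- ln (mass X p {b. tr P b c = tr P a c}))"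
        using mass_nonneg[OF p, of "{b. tr P b c = tr P a c}"]
        by (cases "q c = 0"; cases "mass X p {b. tr P b c = tr P a c} = 0") (auto simp: ln_div)
      then show "p a * q c * (- ln (mass X p {b. tr P b c = tr P a c})) = p a * q c *
        ln ((\<Sum>b\<in>X. p b * q c) / (\<Sum>b\<in>X. p b * q c * of_bool (tr P b c = tr P a c)))"
        unfolding s1 s2 by simp
    qed
    also have "\<dots> \<le> ?R"
      using p0 q0[OF c] dom c \<eta> by (intro cross_entropy_ge[OF X]) auto
    finally show ?thesis .
  qed
  have "\<eta> / ln 2 * (\<Sum>P\<in>set_pmf RP. pmf RP P * (\<Sum>c\<in>Y. \<Sum>a\<in>X. p a * q c *
      (- ln (mass X p {b. tr P b c = tr P a c}))))
    = (\<Sum>P\<in>set_pmf RP. pmf RP P * (\<Sum>c\<in>Y. \<eta> * (\<Sum>a\<in>X. p a * q c *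
      (- ln (mass X p {b. tr P b c = tr P a c}))))) / ln 2"
    by (simp add: sum_distrib_left sum_divide_distrib mult_ac)
  also have "\<dots> \<le> cmi (map_pmf (\<lambda>((a, c), P). (a, (P, tr P a c), c)) (pair_pmf K RP))"
    unfolding cmi_transcript[OF X Y K RP]
    by (intro divide_right_mono sum_mono mult_left_mono main) auto
  finally show ?thesis .
qed

text \<open>The case \<open>r = 0\<close> of \<open>cross_entropy_ge\<close>.\<close>

lemma cmi_transcript_nonneg:
  fixes K :: "('a::countable \<times> 'c::countable) pmf" and RP :: "'p pmf" and tr :: "'p \<Rightarrow> 'a \<Rightarrow> 'c \<Rightarrow> 't"
  assumes X: "finite X" and Y: "finite Y" and K: "set_pmf K \<subseteq> X \<times> Y" and RP: "finite (set_pmf RP)"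
  shows "0 \<le> cmi (map_pmf (\<lambda>((a, c), P). (a, (P, tr P a c), c)) (pair_pmf K RP))"
proof -
  have "0 \<le> (\<Sum>a\<in>X. pmf K (a, c) *
      ln ((\<Sum>b\<in>X. pmf K (b, c)) / (\<Sum>b\<in>X. pmf K (b, c) * of_bool (tr P b c = tr P a c))))" for P c
    using cross_entropy_ge[OF X, of "\<lambda>_. 0" "\<lambda>a. pmf K (a, c)" 1] by simp
  then have "0 \<le> (\<Sum>c\<in>Y. \<Sum>a\<in>X. pmf K (a, c) *
      ln ((\<Sum>b\<in>X. pmf K (b, c)) / (\<Sum>b\<in>X. pmf K (b, c) * of_bool (tr P b c = tr P a c))))" for P
    by (rule sum_nonneg)
  then show ?thesis unfolding cmi_transcript[OF assms]
    by (intro divide_nonneg_pos sum_nonneg[of "set_pmf RP"] mult_nonneg_nonneg[OF pmf_nonneg]) auto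
qed

text \<open>Crude, from \<open>- \<kappa> * ln \<kappa> \<le> 1\<close>; what matters is a bound
  independent of \<open>K\<close> and \<open>RP\<close>, so that the supremum in \<open>IC\<close>
  is over a bounded set.\<close>

lemma cmi_transcript_le:
  fixes K :: "('a::countable \<times> 'c::countable) pmf" and RP :: "'p pmf" and tr :: "'p \<Rightarrow> 'a \<Rightarrow> 'c \<Rightarrow> 't"
  assumes X: "finite X" and Y: "finite Y" and K: "set_pmf K \<subseteq> X \<times> Y" and RP: "finite (set_pmf RP)"
  shows "cmi (map_pmf (\<lambda>((a, c), P). (a, (P, tr P a c), c)) (pair_pmf K RP)) \<le> real (card X * card Y) / ln 2"
proof -
  have "pmf K (a, c) * ln ((\<Sum>b\<in>X. pmf K (b, c)) / (\<Sum>b\<in>X. pmf K (b, c) * of_bool (tr P b c = tr P a c))) \<le> 1"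
    (is "?\<kappa> * ln (?U / ?S) \<le> 1") if a: "a \<in> X" and c: "c \<in> Y" for P a c
  proof (cases "?\<kappa> = 0")
    case False
    then have \<kappa>: "0 < ?\<kappa>" by (simp add: order_less_le)
    have "?\<kappa> * of_bool (tr P a c = tr P a c) \<le> ?S"
      by (rule member_le_sum[of a X "\<lambda>b. pmf K (b, c) * of_bool (tr P b c = tr P a c)"]) (use a X in auto)
    then have S: "?\<kappa> \<le> ?S" by simp
    have "?S \<le> ?U" by (intro sum_mono) auto
    moreover have "?U \<le> 1"
    proof -
      have "?U = sum (pmf K) ((\<lambda>b. (b, c)) ` X)" by (subst sum.reindex) (auto simp: inj_on_def)
      also have "\<dots> = measure_pmf.prob K ((\<lambda>b. (b, c)) ` X)"
        using X by (intro measure_measure_pmf_finite[symmetric]) auto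
      finally show ?thesis by simp
    qed
    ultimately have "?U / ?S \<le> 1 / ?\<kappa>" using S \<kappa> by (intro frac_le) auto
    moreover have "0 < ?U / ?S" using \<kappa> S \<open>?S \<le> ?U\<close> by (intro divide_pos_pos) linarith+
    ultimately have "ln (?U / ?S) \<le> ln (1 / ?\<kappa>)" using \<kappa> by (subst ln_le_cancel_iff) auto
    then have "?\<kappa> * ln (?U / ?S) \<le> ?\<kappa> * ln (1 / ?\<kappa>)" using \<kappa> by (intro mult_left_mono) auto
    also have "\<dots> \<le> ?\<kappa> * (1 / ?\<kappa> - 1)" using \<kappa> by (intro mult_left_mono ln_le_minus_one) auto
    also have "\<dots> \<le> 1" using \<kappa> by (simp add: algebra_simps)
    finally show ?thesis .
  qed simp
  then have "cmi (map_pmf (\<lambda>((a, c), P). (a, (P, tr P a c), c)) (pair_pmf K RP))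
    \<le> (\<Sum>P\<in>set_pmf RP. pmf RP P * (\<Sum>c\<in>Y. \<Sum>a\<in>X. 1)) / ln 2"
    unfolding cmi_transcript[OF assms] by (intro divide_right_mono sum_mono mult_left_mono) auto
  also have "\<dots> = (\<Sum>P\<in>set_pmf RP. pmf RP P) * real (card X * card Y) / ln 2"
    by (simp add: sum_distrib_right sum_distrib_left mult_ac)
  finally show ?thesis using RP by (simp add: sum_pmf_eq_1)
qed

text \<open>Swapping the inputs in the second term brings both terms into the shape of the
  \<open>cmi_transcript\<close> lemmas.\<close>

lemma IC_prot_alt:
  "IC_prot \<mu> RP =
     cmi (map_pmf (\<lambda>((x, y), P). (x, (P, trans P x y), y)) (pair_pmf \<mu> RP)) +
     cmi (map_pmf (\<lambda>((y, x), P). (y, (P, trans P x y), x)) (pair_pmf (map_pmf prod.swap \<mu>) RP))"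
proof -
  have "pair_pmf (map_pmf prod.swap \<mu>) RP = map_pmf (\<lambda>(z, P). (prod.swap z, P)) (pair_pmf \<mu> RP)"
    using map_pair[of prod.swap id \<mu> RP] by (simp add: pmf.map_id)
  then have "map_pmf (\<lambda>((y, x), P). (y, (P, trans P x y), x)) (pair_pmf (map_pmf prod.swap \<mu>) RP)
    = map_pmf (\<lambda>((x, y), P). (y, (P, trans P x y), x)) (pair_pmf \<mu> RP)"
    by (simp add: pmf.map_comp o_def case_prod_unfold)
  then show ?thesis by (simp add: IC_prot_def)
qed

section \<open>Finiteness of information cost and near-optimal protocols\<close>

lemma swap_support: "set_pmf K \<subseteq> X \<times> Y \<Longrightarrow> set_pmf (map_pmf prod.swap K) \<subseteq> Y \<times> X"
  by auto

lemma IC_prot_nonneg: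
  assumes "input_dist n \<mu>" "finite (set_pmf RP)"
  shows "0 \<le> IC_prot \<mu> RP"
  unfolding IC_prot_alt using assms unfolding input_dist_def
  by (intro add_nonneg_nonneg cmi_transcript_nonneg[OF finite_cube[of n] finite_cube[of n]] swap_support)

lemma IC_prot_le:
  assumes "input_dist n \<mu>" "finite (set_pmf RP)"
  shows "IC_prot \<mu> RP \<le> 2 * (real (card (cube n) * card (cube n)) / ln 2)"
  unfolding IC_prot_alt mult_2 using assms unfolding input_dist_def
  by (intro add_mono cmi_transcript_le[OF finite_cube[of n] finite_cube[of n]] swap_support)

text \<open>Alice's input is found by testing the elements of \<open>X\<close> one at a time, then
  Bob announces the value.\<close>

lemma exists_exact_protocol:
  fixes f :: "'a \<Rightarrow> 'b \<Rightarrow> bool"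
  shows "finite X \<Longrightarrow> \<exists>P. \<forall>x\<in>X. \<forall>y. deval P x y = f x y"
proof (induction X rule: finite_induct)
  case (insert a X)
  then obtain P where P: "\<forall>x\<in>X. \<forall>y. deval P x y = f x y" by blast
  then show ?case
    by (intro exI[of _ "ANode (\<lambda>x. x = a) (BNode (f a) (Leaf True) (Leaf False)) P"]) auto
qed auto

text \<open>\<open>Inf\<close> and \<open>Sup\<close> of reals are meaningful only for nonempty,
  suitably bounded sets; the exact protocol and the crude bounds on \<open>IC_prot\<close> provide
  this. The slack 1 avoids asking whether the infimum is attained.\<close>

lemma IC_near_optimal:
  assumes K: "input_dist n K"
  obtains RP where "finite (set_pmf RP)" "rand_err K f RP \<le> 1/8" "IC_prot K RP \<le> IC n (1/8) f + 1"
proof -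
  define C where "C = 2 * (real (card (cube n) * card (cube n)) / ln 2)"
  let ?S = "\<lambda>\<mu>. {IC_prot \<mu> RP | RP. finite (set_pmf RP) \<and> rand_err \<mu> f RP \<le> 1/8}"
  obtain P where P: "\<forall>x\<in>cube n. \<forall>y. deval P x y = f x y" using exists_exact_protocol[OF finite_cube[of n], of f] by blast
  have ex: "IC_prot \<mu> (return_pmf P) \<in> ?S \<mu>" if \<mu>: "input_dist n \<mu>" for \<mu>
  proof -
    have "rand_err \<mu> f (return_pmf P) = 0"
      unfolding rand_err_def measure_pmf_zero_iff using \<mu> P by (auto simp: input_dist_def)
    then show ?thesis by (intro CollectI exI[of _ "return_pmf P"]) auto
  qed
  have bb: "bdd_below (?S \<mu>)" if "input_dist n \<mu>" for \<mu>
    using IC_prot_nonneg[OF that] by (intro bdd_belowI[of _ 0]) auto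
  have le: "IC_dist \<mu> (1/8) f \<le> C" if \<mu>: "input_dist n \<mu>" for \<mu>
  proof -
    have "IC_dist \<mu> (1/8) f \<le> IC_prot \<mu> (return_pmf P)"
      unfolding IC_dist_def by (rule cInf_lower[OF ex[OF \<mu>] bb[OF \<mu>]])
    also have "\<dots> \<le> C" unfolding C_def by (rule IC_prot_le[OF \<mu>]) simp
    finally show ?thesis .
  qed
  have "IC_dist K (1/8) f \<le> IC n (1/8) f"
    unfolding IC_def using K le by (intro cSup_upper bdd_aboveI[of _ C]) auto
  then have "Inf (?S K) < IC n (1/8) f + 1" unfolding IC_dist_def by simp
  then obtain v where "v \<in> ?S K" "v < IC n (1/8) f + 1" using cInf_lessD[of "?S K"] ex[OF K] by blast
  then show ?thesis using that by auto
qed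

lemma IC_ge_minus_1:
  assumes "input_dist n \<mu>"
  shows "- 1 \<le> IC n (1/8) f"
proof -
  obtain RP where RP: "finite (set_pmf RP)" "IC_prot \<mu> RP \<le> IC n (1/8) f + 1"
    by (rule IC_near_optimal[OF assms])
  then show ?thesis using IC_prot_nonneg[OF assms RP(1)] by simp
qed

section \<open>Rectangle covers from protocols\<close>

text \<open>The rectangle property of protocols: at each node the bit depends on one input
  only.\<close>

lemma trans_rectangle:
  "trans P x' y' = trans P x y \<longleftrightarrow> trans P x' y = trans P x y \<and> trans P x y' = trans P x y"
  by (induction P) auto

lemma deval_eq_if_trans_eq: "trans P x' y' = trans P x y \<Longrightarrow> deval P x' y' = deval P x y"
  by (induction P) (auto split: if_splits)

type_synonym 'a labelled_rect = "bool \<times> 'a set \<times> 'a set"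

abbreviation rects :: "'a set \<Rightarrow> 'a labelled_rect set" where
  "rects X \<equiv> UNIV \<times> Pow X \<times> Pow X"

abbreviation rowset :: "'a labelled_rect \<Rightarrow> 'a set" where "rowset j \<equiv> fst (snd j)"
abbreviation colset :: "'a labelled_rect \<Rightarrow> 'a set" where "colset j \<equiv> snd (snd j)"

text \<open>A leaf is named by an input reaching it, so for \<open>x\<close> and \<open>y\<close> in
  \<open>X\<close> the rectangle is nonempty.\<close>

definition leaf_rect :: "'a set \<Rightarrow> ('a, 'a, bool) dprot \<Rightarrow> 'a \<Rightarrow> 'a \<Rightarrow> 'a labelled_rect" where
  "leaf_rect X P x y = (deval P x y, {x'\<in>X. trans P x' y = trans P x y}, {y'\<in>X. trans P x y' = trans P x y})"

definition leaf_weight :: "'a set \<Rightarrow> ('a, 'a, bool) dprot \<Rightarrow> 'a labelled_rect \<Rightarrow> real" where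
  "leaf_weight X P j = of_bool (\<exists>x\<in>X. \<exists>y\<in>X. j = leaf_rect X P x y)"

text \<open>An input inside a leaf rectangle has the transcript of that leaf, so the leaf rectangles
  partition the inputs.\<close>

lemma leaf_rect_unique:
  assumes "x \<in> X" "y \<in> X" "x \<in> rowset (leaf_rect X P x' y')" "y \<in> colset (leaf_rect X P x' y')"
  shows "leaf_rect X P x' y' = leaf_rect X P x y"
proof -
  have t: "trans P x y = trans P x' y'"
    using assms trans_rectangle[of P x y x' y'] by (simp add: leaf_rect_def)
  have "trans P x'' y' = trans P x' y' \<longleftrightarrow> trans P x'' y = trans P x y" for x''
    using t by (metis trans_rectangle)
  moreover have "trans P x' y'' = trans P x' y' \<longleftrightarrow> trans P x y'' = trans P x y" for y''
    using t by (metis trans_rectangle)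
  ultimately show ?thesis using deval_eq_if_trans_eq[OF t] by (simp add: leaf_rect_def)
qed

lemma sum_leaf_weight:
  assumes X: "finite X" and xy: "x \<in> X" "y \<in> X"
  shows "(\<Sum>j\<in>rects X. leaf_weight X P j * c j * of_bool (x \<in> rowset j) * of_bool (y \<in> colset j))
    = c (leaf_rect X P x y)"
proof -
  have mem: "leaf_rect X P x y \<in> rects X" by (auto simp: leaf_rect_def)
  have "leaf_weight X P j * c j * of_bool (x \<in> rowset j) * of_bool (y \<in> colset j)
    = (if j = leaf_rect X P x y then c j else 0)" for j
  proof (cases "j = leaf_rect X P x y")
    case True
    then have "x \<in> rowset j" "y \<in> colset j" using xy by (auto simp: leaf_rect_def)
    then show ?thesis using True xy by (auto simp: leaf_weight_def)
  next
    case False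
    then show ?thesis using leaf_rect_unique[OF xy] by (auto simp: leaf_weight_def)
  qed
  then show ?thesis using X mem by simp
qed

definition mix_weight :: "'a set \<Rightarrow> ('a, 'a, bool) dprot pmf \<Rightarrow> 'a labelled_rect \<Rightarrow> real" where
  "mix_weight X RP j = (\<Sum>P\<in>set_pmf RP. pmf RP P * leaf_weight X P j)"

lemma mix_weight_nonneg: "0 \<le> mix_weight X RP j"
  by (auto simp: mix_weight_def leaf_weight_def intro!: sum_nonneg)

text \<open>Used three times: \<open>c = 1\<close> gives the coverage, the indicator of the right
  label gives the success probability, and a logarithm of masses gives the potential.\<close>

lemma sum_mix_weight:
  assumes X: "finite X" and xy: "x \<in> X" "y \<in> X"
  shows "(\<Sum>j\<in>rects X. mix_weight X RP j * c j * of_bool (x \<in> rowset j) * of_bool (y \<in> colset j))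
    = (\<Sum>P\<in>set_pmf RP. pmf RP P * c (leaf_rect X P x y))"
proof -
  have "(\<Sum>j\<in>rects X. mix_weight X RP j * c j * of_bool (x \<in> rowset j) * of_bool (y \<in> colset j))
    = (\<Sum>j\<in>rects X. \<Sum>P\<in>set_pmf RP. pmf RP P * (leaf_weight X P j * c j * of_bool (x \<in> rowset j) * of_bool (y \<in> colset j)))"
    by (simp add: mix_weight_def sum_distrib_right mult.assoc)
  also have "\<dots> = (\<Sum>P\<in>set_pmf RP. pmf RP P * (\<Sum>j\<in>rects X. leaf_weight X P j * c j * of_bool (x \<in> rowset j) * of_bool (y \<in> colset j)))"
    by (subst sum.swap) (simp add: sum_distrib_left)
  finally show ?thesis by (simp only: sum_leaf_weight[OF assms])
qed

text \<open>The sides of a leaf rectangle have as masses the probabilities of the transcript given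
  \<open>y\<close> and given \<open>x\<close>. The logarithm of their product splits accordingly,
  and each part is bounded by one term of \<open>IC_prot\<close>.\<close>

lemma IC_prot_ge_entropy:
  fixes n :: nat and p q :: "bool list \<Rightarrow> real"
  defines "X \<equiv> cube n"
  assumes K: "input_dist n K" and RP: "finite (set_pmf RP)"
    and p: "prob_weights X p" and q: "prob_weights X q" and \<eta>: "0 < \<eta>"
    and dom: "\<And>x y. x \<in> X \<Longrightarrow> y \<in> X \<Longrightarrow> \<eta> * (p x * q y) \<le> pmf K (x, y)"
  shows "\<eta> / ln 2 * (\<Sum>j\<in>rects X. mix_weight X RP j * ent (mass X p (rowset j) * mass X q (colset j)))
    \<le> IC_prot K RP"
proof -
  have X: "finite X" using finite_cube by (simp add: X_def)
  have K': "set_pmf K \<subseteq> X \<times> X" using K by (simp add: input_dist_def X_def)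
  have p0: "0 \<le> p x" if "x \<in> X" for x using p that by (simp add: prob_weights_def)
  have q0: "0 \<le> q x" if "x \<in> X" for x using q that by (simp add: prob_weights_def)
  define hx hy where "hx P x y = - ln (mass X p {b. trans P b y = trans P x y})"
    and "hy P x y = - ln (mass X q {b. trans P x b = trans P x y})" for P :: bprot and x y
  let ?c = "\<lambda>j. - ln (mass X p (rowset j) * mass X q (colset j))"
  have leaf: "p x * q y * ?c (leaf_rect X P x y) = p x * q y * (hx P x y + hy P x y)"
    if xy: "x \<in> X" "y \<in> X" for P x y
  proof (cases "p x = 0 \<or> q y = 0")
    case False
    have m: "mass X p (rowset (leaf_rect X P x y)) = mass X p {b. trans P b y = trans P x y}"
      "mass X q (colset (leaf_rect X P x y)) = mass X q {b. trans P x b = trans P x y}"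
      unfolding mass_def leaf_rect_def by (auto intro!: sum.cong)
    have "0 < mass X p {b. trans P b y = trans P x y}"
      unfolding mass_def using False xy p0 by (intro sum_pos2[OF X xy(1)]) (auto simp: order_less_le)
    moreover have "0 < mass X q {b. trans P x b = trans P x y}"
      unfolding mass_def using False xy q0 by (intro sum_pos2[OF X xy(2)]) (auto simp: order_less_le)
    ultimately show ?thesis by (simp add: m hx_def hy_def ln_mult)
  qed auto
  have "(\<Sum>j\<in>rects X. mix_weight X RP j * ent (mass X p (rowset j) * mass X q (colset j)))
    = (\<Sum>j\<in>rects X. mix_weight X RP j * ?c j * (mass X p (rowset j) * mass X q (colset j)))"
    by (simp add: ent_def mult_ac)
  also have "\<dots> = (\<Sum>x\<in>X. \<Sum>y\<in>X. p x * q y * (\<Sum>P\<in>set_pmf RP. pmf RP P * ?c (leaf_rect X P x y)))"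
    unfolding sum_mass_prod by (intro sum.cong refl arg_cong2[where f = "(*)"] sum_mix_weight X)
  also have "\<dots> = (\<Sum>x\<in>X. \<Sum>y\<in>X. \<Sum>P\<in>set_pmf RP. pmf RP P * (p x * q y * (hx P x y + hy P x y)))"
    unfolding sum_distrib_left by (intro sum.cong refl) (simp only: mult.left_commute leaf)
  also have "\<dots> = (\<Sum>x\<in>X. \<Sum>P\<in>set_pmf RP. \<Sum>y\<in>X. pmf RP P * (p x * q y * (hx P x y + hy P x y)))"
    by (rule sum.cong[OF refl]) (rule sum.swap)
  also have "\<dots> = (\<Sum>P\<in>set_pmf RP. \<Sum>x\<in>X. \<Sum>y\<in>X. pmf RP P * (p x * q y * (hx P x y + hy P x y)))"
    by (rule sum.swap)
  also have "\<dots> = (\<Sum>P\<in>set_pmf RP. pmf RP P * (\<Sum>x\<in>X. \<Sum>y\<in>X. p x * q y * hx P x y))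
     + (\<Sum>P\<in>set_pmf RP. pmf RP P * (\<Sum>x\<in>X. \<Sum>y\<in>X. p x * q y * hy P x y))"
    by (simp add: sum_distrib_left distrib_left sum.distrib)
  also have "(\<Sum>P\<in>set_pmf RP. pmf RP P * (\<Sum>x\<in>X. \<Sum>y\<in>X. p x * q y * hx P x y))
    = (\<Sum>P\<in>set_pmf RP. pmf RP P * (\<Sum>y\<in>X. \<Sum>x\<in>X. p x * q y * hx P x y))"
    by (subst sum.swap) simp
  finally have eq: "(\<Sum>j\<in>rects X. mix_weight X RP j * ent (mass X p (rowset j) * mass X q (colset j)))
    = (\<Sum>P\<in>set_pmf RP. pmf RP P * (\<Sum>y\<in>X. \<Sum>x\<in>X. p x * q y * hx P x y))
     + (\<Sum>P\<in>set_pmf RP. pmf RP P * (\<Sum>x\<in>X. \<Sum>y\<in>X. q y * p x * hy P x y))"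
    by (simp add: mult.commute[of "p _" "q _"])
  have 1: "\<eta> / ln 2 * (\<Sum>P\<in>set_pmf RP. pmf RP P * (\<Sum>y\<in>X. \<Sum>x\<in>X. p x * q y * hx P x y))
    \<le> cmi (map_pmf (\<lambda>((x, y), P). (x, (P, trans P x y), y)) (pair_pmf K RP))"
    unfolding hx_def by (rule cmi_transcript_ge[OF X X K' RP p q \<eta> dom])
  have swap: "pmf (map_pmf prod.swap K) (y, x) = pmf K (x, y)" for x y
    using pmf_map_inj'[of prod.swap K "(x, y)"] by simp
  have 2: "\<eta> / ln 2 * (\<Sum>P\<in>set_pmf RP. pmf RP P * (\<Sum>x\<in>X. \<Sum>y\<in>X. q y * p x * hy P x y))
    \<le> cmi (map_pmf (\<lambda>((y, x), P). (y, (P, trans P x y), x)) (pair_pmf (map_pmf prod.swap K) RP))"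
    unfolding hy_def
    by (rule cmi_transcript_ge[OF X X swap_support[OF K'] RP q p \<eta>, where tr = "\<lambda>P y x. trans P x y"])
      (use dom in \<open>simp add: swap mult.commute\<close>)
  show ?thesis unfolding eq IC_prot_alt distrib_left using 1 2 by (rule add_mono)
qed

section \<open>Minimax over covers of small potential\<close>

lemma exists_pmf_of_weights:
  assumes "finite S" "prob_weights S r"
  obtains K where "set_pmf K \<subseteq> S" "\<And>s. s \<in> S \<Longrightarrow> pmf K s = r s"
proof -
  let ?g = "\<lambda>s. if s \<in> S then r s else 0"
  have "(\<integral>\<^sup>+ s. ennreal (?g s) \<partial>count_space UNIV) = (\<Sum>s\<in>S. ennreal (?g s))"
    using assms by (intro nn_integral_count_space') (auto simp: prob_weights_def)
  also have "\<dots> = ennreal (\<Sum>s\<in>S. r s)"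
    using assms by (subst sum_ennreal[symmetric]) (auto simp: prob_weights_def intro!: sum.cong)
  finally have 1: "(\<integral>\<^sup>+ s. ennreal (?g s) \<partial>count_space UNIV) = 1"
    using assms by (simp add: prob_weights_def)
  have 0: "0 \<le> ?g s" for s using assms by (simp add: prob_weights_def)
  show ?thesis
  proof (rule that[of "embed_pmf ?g"])
    show "set_pmf (embed_pmf ?g) \<subseteq> S" unfolding set_embed_pmf[of ?g, OF 0 1] by auto
    show "pmf (embed_pmf ?g) s = r s" if "s \<in> S" for s using pmf_embed_pmf[of ?g, OF 0 1] that by simp
  qed
qed

lemma rand_err_eq:
  assumes K: "input_dist n K" and RP: "finite (set_pmf RP)"
  shows "rand_err K f RP = (\<Sum>(x, y)\<in>cube n \<times> cube n. pmf K (x, y) *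
    (\<Sum>P\<in>set_pmf RP. pmf RP P * of_bool (deval P x y \<noteq> f x y)))"
proof -
  have "rand_err K f RP = (\<Sum>z\<in>(cube n \<times> cube n) \<times> set_pmf RP. pmf (pair_pmf K RP) z *
      of_bool (z \<in> {((x, y), P). deval P x y \<noteq> f x y}))"
    unfolding rand_err_def using K RP finite_cube by (intro prob_eq_sum) (auto simp: input_dist_def)
  also have "\<dots> = (\<Sum>z\<in>cube n \<times> cube n. \<Sum>P\<in>set_pmf RP. pmf K z * (pmf RP P * of_bool (deval P (fst z) (snd z) \<noteq> f (fst z) (snd z))))"
    unfolding sum.cartesian_product by (intro sum.cong refl) (auto simp: pmf_pair)
  finally show ?thesis by (simp add: sum_distrib_left case_prod_unfold)
qed

text \<open>A share 1/50 of the product weights in the adversary's distribution bounds the potential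
  by 50 times the near-optimal information cost, while the error rises to at most 1/8 * 50/49 =
  50/392. With 1/500 for the approximate minimax this stays below 13/100.\<close>

lemma exists_low_entropy_cover:
  fixes n :: nat and p q :: "bool list \<Rightarrow> real"
  defines "X \<equiv> cube n"
  assumes p: "prob_weights X p" and q: "prob_weights X q"
  shows "\<exists>w. rectangle_cover X X (rects X) w rowset colset fst f \<and>
    (\<Sum>j\<in>rects X. w j * ent (mass X p (rowset j) * mass X q (colset j))) \<le> 50 * (IC n (1/8) f + 1)"
proof -
  have X: "finite X" using finite_cube by (simp add: X_def)
  define h where "h w = (\<Sum>j\<in>rects X. w j * ent (mass X p (rowset j) * mass X q (colset j)))" for w
  define cov where "cov w x y = (\<Sum>j\<in>rects X. w j * of_bool (x \<in> rowset j) * of_bool (y \<in> colset j))" for w :: "bool list labelled_rect \<Rightarrow> real" and x y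
  define cor where "cor w x y = (\<Sum>j\<in>rects X. w j * of_bool (fst j = f x y) * of_bool (x \<in> rowset j) * of_bool (y \<in> colset j))"
    for w :: "bool list labelled_rect \<Rightarrow> real" and x y
  define I where "I = 50 * (IC n (1/8) f + 1)"
  \<comment> \<open>Potential, coverage and correctness are linear in the weights, so
    \<open>W\<close> is convex.\<close>
  define W where "W = {w. (\<forall>j. 0 \<le> w j) \<and> (\<forall>x\<in>X. \<forall>y\<in>X. cov w x y = 1) \<and> h w \<le> I}"
  define err' where "err' w s = 1 - cor w (fst s) (snd s)" for w s
  have "\<exists>e\<in>err' ` W. \<forall>s\<in>X \<times> X. e s \<le> 50/392 + 1/500"
  proof (rule approx_minimax)
    have "X \<noteq> {}" using p by (auto simp: prob_weights_def)
    then show "finite (X \<times> X)" "X \<times> X \<noteq> {}" using X by auto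
  next
    fix e e' :: "bool list \<times> bool list \<Rightarrow> real" and t :: real
    assume "e \<in> err' ` W" "e' \<in> err' ` W" and t: "0 \<le> t" "t \<le> 1"
    then obtain w w' where w: "w \<in> W" "e = err' w" and w': "w' \<in> W" "e' = err' w'" by blast
    let ?w = "\<lambda>j. (1 - t) * w j + t * w' j"
    have lin: "cov ?w x y = (1 - t) * cov w x y + t * cov w' x y"
      "cor ?w x y = (1 - t) * cor w x y + t * cor w' x y" "h ?w = (1 - t) * h w + t * h w'" for x y
      unfolding cov_def cor_def h_def sum_distrib_left sum.distrib[symmetric]
      by (intro sum.cong refl; simp add: algebra_simps)+
    have "h ?w \<le> (1 - t) * I + t * I"
      unfolding lin using w w' t by (intro add_mono mult_left_mono) (auto simp: W_def)
    then have "h ?w \<le> I" by (simp add: algebra_simps)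
    moreover have "cov ?w x y = 1" if "x \<in> X" "y \<in> X" for x y
      using w w' that by (simp add: lin W_def)
    moreover have "0 \<le> ?w j" for j using w w' t by (cases j) (simp add: W_def)
    ultimately have "?w \<in> W" by (simp add: W_def)
    moreover have "(\<lambda>s. (1 - t) * e s + t * e' s) = err' ?w"
      by (intro ext) (simp only: w w' err'_def lin, simp add: algebra_simps)
    ultimately show "(\<lambda>s. (1 - t) * e s + t * e' s) \<in> err' ` W" by blast
  next
    fix e :: "bool list \<times> bool list \<Rightarrow> real" and s
    assume "e \<in> err' ` W" and s: "s \<in> X \<times> X"
    then obtain w where w: "w \<in> W" "e = err' w" by blast
    have "0 \<le> cor w (fst s) (snd s)" unfolding cor_def using w by (intro sum_nonneg) (auto simp: W_def)
    moreover have "cor w (fst s) (snd s) \<le> cov w (fst s) (snd s)"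
      unfolding cor_def cov_def using w by (intro sum_mono) (auto simp: W_def)
    ultimately show "0 \<le> e s \<and> e s \<le> 1" using w s by (auto simp: W_def err'_def)
  next
    fix \<nu> :: "bool list \<times> bool list \<Rightarrow> real"
    assume \<nu>: "prob_weights (X \<times> X) \<nu>"
    define r where "r s = 1/50 * (p (fst s) * q (snd s)) + 49/50 * \<nu> s" for s
    have "(\<Sum>s\<in>X \<times> X. p (fst s) * q (snd s)) = 1"
      using sum_prod_weights[OF p q] by (simp add: sum.cartesian_product case_prod_unfold)
    then have "(\<Sum>s\<in>X \<times> X. r s) = 1"
      using \<nu> by (simp add: r_def sum.distrib prob_weights_def flip: sum_distrib_left sum_divide_distrib)
    then have "prob_weights (X \<times> X) r"
      using \<nu> p q by (auto simp: prob_weights_def r_def)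
    then obtain K where K: "set_pmf K \<subseteq> X \<times> X" "\<And>s. s \<in> X \<times> X \<Longrightarrow> pmf K s = r s"
      using exists_pmf_of_weights[of "X \<times> X" r] X by blast
    have Kn: "input_dist n K" using K by (simp add: input_dist_def X_def)
    obtain RP where RP: "finite (set_pmf RP)" "rand_err K f RP \<le> 1/8" "IC_prot K RP \<le> IC n (1/8) f + 1"
      by (rule IC_near_optimal[OF Kn])
    have RP1: "(\<Sum>P\<in>set_pmf RP. pmf RP P) = 1" using RP by (simp add: sum_pmf_eq_1)
    let ?w = "mix_weight X RP"
    have cov: "cov ?w x y = 1" if "x \<in> X" "y \<in> X" for x y
      using sum_mix_weight[OF X that, of RP "\<lambda>_. 1"] RP1 by (simp add: cov_def)
    have cor: "cor ?w x y = (\<Sum>P\<in>set_pmf RP. pmf RP P * of_bool (deval P x y = f x y))" if "x \<in> X" "y \<in> X" for x y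
      using sum_mix_weight[OF X that, of RP "\<lambda>j. of_bool (fst j = f x y)"] by (simp add: cor_def leaf_rect_def)
    have "1/50 / ln 2 * h ?w \<le> IC_prot K RP"
      unfolding h_def X_def
    proof (rule IC_prot_ge_entropy[OF Kn RP(1) p[unfolded X_def] q[unfolded X_def]])
      fix x y assume xy: "x \<in> cube n" "y \<in> cube n"
      then have "0 \<le> \<nu> (x, y)" using \<nu> by (auto simp: prob_weights_def X_def)
      then show "1/50 * (p x * q y) \<le> pmf K (x, y)" using xy K(2)[of "(x, y)"] by (simp add: r_def X_def)
    qed simp
    then have "1/50 / ln 2 * h ?w \<le> IC n (1/8) f + 1" using RP by simp
    then have "h ?w \<le> 50 * ln 2 * (IC n (1/8) f + 1)" by (simp add: field_simps)
    \<comment> \<open>The last factor is nonnegative because it bounds the information cost of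
      \<open>RP\<close>.\<close>
    moreover have "ln 2 * (IC n (1/8) f + 1) \<le> 1 * (IC n (1/8) f + 1)"
      using IC_prot_nonneg[OF Kn RP(1)] RP(3) ln_2_less_1 by (intro mult_right_mono) auto
    ultimately have "h ?w \<le> I" by (simp add: I_def)
    then have wW: "?w \<in> W" using cov by (auto simp: W_def mix_weight_nonneg)
    have e: "err' ?w s = (\<Sum>P\<in>set_pmf RP. pmf RP P * of_bool (deval P (fst s) (snd s) \<noteq> f (fst s) (snd s)))"
      if "s \<in> X \<times> X" for s
    proof -
      have "fst s \<in> X" "snd s \<in> X" using that by auto
      then show ?thesis
        unfolding err'_def cor[OF \<open>fst s \<in> X\<close> \<open>snd s \<in> X\<close>] RP1[symmetric] sum_subtractf[symmetric]
        by (intro sum.cong refl) auto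
    qed
    have "49/50 * (\<Sum>s\<in>X \<times> X. \<nu> s * err' ?w s) = (\<Sum>s\<in>X \<times> X. 49/50 * \<nu> s * err' ?w s)"
      by (simp add: sum_distrib_left mult.assoc)
    also have "\<dots> \<le> (\<Sum>s\<in>X \<times> X. pmf K s * err' ?w s)"
    proof (intro sum_mono mult_right_mono)
      fix s assume s: "s \<in> X \<times> X"
      show "0 \<le> err' ?w s" unfolding e[OF s] by (intro sum_nonneg) auto
      have "0 \<le> p (fst s) * q (snd s)" using s p q by (auto simp: prob_weights_def)
      then show "49/50 * \<nu> s \<le> pmf K s" using K(2)[OF s] by (simp add: r_def)
    qed
    also have "\<dots> = rand_err K f RP"
      unfolding rand_err_eq[OF Kn RP(1)] X_def[symmetric] by (intro sum.cong refl) (auto simp: e)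
    finally have "(\<Sum>s\<in>X \<times> X. \<nu> s * err' ?w s) \<le> 50/392" using RP(2) by simp
    then show "\<exists>e\<in>err' ` W. (\<Sum>s\<in>X \<times> X. \<nu> s * e s) \<le> 50/392" using wW by blast
  qed auto
  then obtain w where w: "w \<in> W" "\<And>x y. x \<in> X \<Longrightarrow> y \<in> X \<Longrightarrow> 1 - cor w x y \<le> 50/392 + 1/500"
    by (force simp: err'_def)
  have "rectangle_cover X X (rects X) w rowset colset fst f"
  proof
    show "finite (rects X)" using X by simp
    show "(\<Sum>j\<in>rects X. w j * of_bool (x \<in> rowset j) * of_bool (y \<in> colset j)) \<le> 1" if "x \<in> X" "y \<in> X" for x y
      using w(1) that by (simp add: W_def cov_def)
    show "87/100 \<le> (\<Sum>j\<in>rects X. w j * of_bool (fst j = f x y) * of_bool (x \<in> rowset j) * of_bool (y \<in> colset j))"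
      if "x \<in> X" "y \<in> X" for x y
      using w(2)[OF that] by (simp add: cor_def)
  qed (use w in \<open>auto simp: W_def\<close>)
  then show ?thesis using w(1) by (auto simp: W_def h_def I_def)
qed

section \<open>Rectangle covers from the partition bound\<close>

text \<open>Taking \<open>ln x \<le> x - 1\<close> at \<open>x = 1 / (t * W)\<close> gives
  \<open>ent t \<le> t * ln W + 1 / W\<close>; the two parts add up to at most \<open>ln W\<close>
  and 1.\<close>

lemma (in rectangle_cover) pot_le_ln_total:
  assumes p: "prob_weights X p" and q: "prob_weights Y q" and W: "1 \<le> (\<Sum>j\<in>J. w j)"
  shows "pot p q \<le> ln (\<Sum>j\<in>J. w j) + 1"
proof -
  define W where "W = (\<Sum>j\<in>J. w j)"
  have W1: "1 \<le> W" using W by (simp add: W_def)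
  have e: "ent t \<le> t * ln W + 1 / W" if t: "0 \<le> t" for t
  proof (cases "t = 0")
    case False
    then have t0: "0 < t" using t by simp
    have "ln (1 / (t * W)) \<le> 1 / (t * W) - 1" using t0 W1 by (intro ln_le_minus_one) auto
    then have "- ln t \<le> ln W + 1 / (t * W)" using t0 W1 by (simp add: ln_div ln_mult)
    then have "t * (- ln t) \<le> t * (ln W + 1 / (t * W))" using t by (rule mult_left_mono)
    then show ?thesis using t0 by (simp add: ent_def distrib_left)
  qed (use W1 in \<open>simp add: ent_def\<close>)
  have "pot p q \<le> (\<Sum>j\<in>J. w j * (mass X p (A j) * mass Y q (B j) * ln W + 1 / W))"
    unfolding pot_def using p q w_nonneg by (intro sum_mono mult_left_mono e) (auto simp: mass_nonneg)
  also have "\<dots> = (\<Sum>j\<in>J. w j * (mass X p (A j) * mass Y q (B j))) * ln W + W * (1 / W)"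
    unfolding W_def by (simp only: distrib_left sum.distrib sum_distrib_right mult.assoc)
  also have "\<dots> \<le> 1 * ln W + W * (1 / W)"
    using sum_w_mass_le_1[OF p q] W1 by (intro add_mono mult_right_mono) auto
  finally show ?thesis using W1 unfolding W_def[symmetric] by simp
qed

lemma rectangle_cover_of_feasible:
  fixes n :: nat and w :: "bool \<Rightarrow> bool list set \<times> bool list set \<Rightarrow> real"
  assumes w: "prt_feasible n (1/8) f w"
  defines "X \<equiv> cube n"
  shows "rectangle_cover X X (rects X) (\<lambda>j. w (fst j) (snd j)) rowset colset fst f"
proof
  show "finite (rects X)" using finite_cube by (simp add: X_def)
  show "0 \<le> w (fst j) (snd j)" for j using w[unfolded prt_feasible_def, THEN conjunct1] by blast
  fix x y assume xy: "x \<in> X" "y \<in> X"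
  let ?T = "{R\<in>Pow X \<times> Pow X. x \<in> fst R \<and> y \<in> snd R}"
  have fin: "finite (Pow X \<times> Pow X)" using finite_cube by (simp add: X_def)
  \<comment> \<open>\<open>c\<close> depends on the label only: constant 1 for coverage, an
    indicator for correctness.\<close>
  have conv: "(\<Sum>j\<in>rects X. w (fst j) (snd j) * c (fst j) * of_bool (x \<in> rowset j) * of_bool (y \<in> colset j))
    = (\<Sum>z\<in>UNIV. \<Sum>R\<in>?T. w z R * c z)" for c :: "bool \<Rightarrow> real"
  proof -
    have "(\<Sum>j\<in>rects X. w (fst j) (snd j) * c (fst j) * of_bool (x \<in> rowset j) * of_bool (y \<in> colset j))
      = (\<Sum>z\<in>UNIV. \<Sum>R\<in>Pow X \<times> Pow X. w z R * c z * of_bool (x \<in> fst R) * of_bool (y \<in> snd R))"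
      unfolding sum.cartesian_product by (intro sum.cong refl) auto
    also have "\<dots> = (\<Sum>z\<in>UNIV. \<Sum>R\<in>?T. w z R * c z)"
      using fin by (intro sum.cong refl sum.mono_neutral_cong_right) auto
    finally show ?thesis .
  qed
  note feas = w[unfolded prt_feasible_def, folded X_def, THEN conjunct2, THEN conjunct2]
  have "(\<Sum>R\<in>?T. \<Sum>z\<in>UNIV. w z R) = 1"
    using feas[THEN conjunct2, rule_format, OF xy] .
  then have "(\<Sum>z\<in>UNIV. \<Sum>R\<in>?T. w z R * 1) = 1" by (subst sum.swap) simp
  then show "(\<Sum>j\<in>rects X. w (fst j) (snd j) * of_bool (x \<in> rowset j) * of_bool (y \<in> colset j)) \<le> 1"
    using conv[of "\<lambda>_. 1"] by simp
  have "1 - 1/8 \<le> (\<Sum>R\<in>?T. w (f x y) R)"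
    using feas[THEN conjunct1, rule_format, OF xy] .
  also have "\<dots> = (\<Sum>z\<in>UNIV. \<Sum>R\<in>?T. w z R * of_bool (z = f x y))"
    by (cases "f x y") (simp_all add: UNIV_bool)
  finally show "87/100 \<le> (\<Sum>j\<in>rects X. w (fst j) (snd j) * of_bool (fst j = f x y) * of_bool (x \<in> rowset j) * of_bool (y \<in> colset j))"
    unfolding conv[of "\<lambda>z. of_bool (z = f x y)"] by simp
qed

text \<open>A single input is already covered with total weight 1.\<close>

lemma feasible_total_ge_1:
  assumes w: "prt_feasible n (1/8) f w"
  shows "1 \<le> (\<Sum>z\<in>UNIV. \<Sum>R\<in>Pow (cube n) \<times> Pow (cube n). w z R)"
proof -
  define x where "x = replicate n True"
  have x: "x \<in> cube n" by (simp add: x_def cube_def)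
  let ?T = "{R\<in>Pow (cube n) \<times> Pow (cube n). x \<in> fst R \<and> x \<in> snd R}"
  have "1 = (\<Sum>R\<in>?T. \<Sum>z\<in>UNIV. w z R)" using w x unfolding prt_feasible_def by simp
  also have "\<dots> \<le> (\<Sum>R\<in>Pow (cube n) \<times> Pow (cube n). \<Sum>z\<in>UNIV. w z R)"
    using w finite_cube by (intro sum_mono2) (auto simp: prt_feasible_def intro!: sum_nonneg)
  also have "\<dots> = (\<Sum>z\<in>UNIV. \<Sum>R\<in>Pow (cube n) \<times> Pow (cube n). w z R)" by (rule sum.swap)
  finally show ?thesis .
qed

text \<open>Singleton rectangles with the right label; thus the infimum in \<open>prt\<close> is
  over a nonempty set.\<close>

lemma exists_feasible: "\<exists>w. prt_feasible n (1/8) f w"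
proof -
  let ?w = "\<lambda>z R. of_bool (\<exists>x\<in>cube n. \<exists>y\<in>cube n. R = ({x}, {y}) \<and> z = f x y) :: real"
  have *: "(\<Sum>R\<in>{R\<in>Pow (cube n) \<times> Pow (cube n). x \<in> fst R \<and> y \<in> snd R}. g R) = g ({x}, {y})"
    if "x \<in> cube n" "y \<in> cube n" "\<And>R. g R \<noteq> 0 \<Longrightarrow> x \<in> fst R \<Longrightarrow> y \<in> snd R \<Longrightarrow> R = ({x}, {y})"
    for x y and g :: "bool list set \<times> bool list set \<Rightarrow> real"
  proof -
    have "(\<Sum>R\<in>{R\<in>Pow (cube n) \<times> Pow (cube n). x \<in> fst R \<and> y \<in> snd R}. g R) = (\<Sum>R\<in>{({x}, {y})}. g R)"
      using that finite_cube by (intro sum.mono_neutral_right) auto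
    then show ?thesis by simp
  qed
  have "prt_feasible n (1/8) f ?w"
    unfolding prt_feasible_def
  proof (intro conjI ballI allI impI)
    fix x y assume xy: "x \<in> cube n" "y \<in> cube n"
    show "1 - 1/8 \<le> (\<Sum>R\<in>{R\<in>Pow (cube n) \<times> Pow (cube n). x \<in> fst R \<and> y \<in> snd R}. ?w (f x y) R)"
      using xy by (subst *[OF xy]) auto
    show "(\<Sum>R\<in>{R\<in>Pow (cube n) \<times> Pow (cube n). x \<in> fst R \<and> y \<in> snd R}. \<Sum>z\<in>UNIV. ?w z R) = 1"
      using xy by (subst *[OF xy]) (auto simp: UNIV_bool)
  qed auto
  then show ?thesis by blast
qed

text \<open>Since \<open>prt\<close> is at least 1, its double is strictly above the infimum, so
  some feasible point has a smaller total.\<close>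

lemma prt_near_optimal:
  obtains w where "prt_feasible n (1/8) f w"
    "(\<Sum>z\<in>UNIV. \<Sum>R\<in>Pow (cube n) \<times> Pow (cube n). w z R) \<le> 2 * prt n (1/8) f" "1 \<le> prt n (1/8) f"
proof -
  let ?S = "{(\<Sum>z\<in>UNIV. \<Sum>R\<in>Pow (cube n) \<times> Pow (cube n). w z R) | w. prt_feasible n (1/8) f w}"
  have ne: "?S \<noteq> {}" using exists_feasible by blast
  have 1: "1 \<le> prt n (1/8) f"
    unfolding prt_def using ne feasible_total_ge_1 by (intro cInf_greatest) auto
  then have "Inf ?S < 2 * prt n (1/8) f" unfolding prt_def[symmetric] by linarith
  from cInf_lessD[OF ne this] show ?thesis using that 1 by force
qed

text \<open>Beyond 4 the logarithm is at least 2, so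
  \<open>L * log 2 L \<ge> 2 * L \<ge> 3 + L\<close>; up to 4 the left side is at most 7^2 = 49. For
  \<open>L \<le> 0\<close> any value of the logarithm will do, since the square is
  nonnegative.\<close>

lemma square_le_log_bound:
  fixes L :: real
  assumes "-1 \<le> L"
  shows "(3 + L)\<^sup>2 \<le> (L * log 2 L)\<^sup>2 + 49"
proof (cases "L \<le> 4")
  case True
  then have "(3 + L)\<^sup>2 \<le> 7\<^sup>2" using assms by (intro power_mono) auto
  then have "(3 + L)\<^sup>2 \<le> 49" by simp
  then show ?thesis using zero_le_power2[of "L * log 2 L"] by linarith
next
  case False
  have "log 2 (2 powr 2) \<le> log 2 L" using False by (subst log_le_cancel_iff) auto
  then have "2 \<le> log 2 L" by (subst (asm) log_powr_cancel) auto
  then have "L * 2 \<le> L * log 2 L" using False by (intro mult_left_mono) auto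
  then have "3 + L \<le> L * log 2 L" using False by linarith
  then have "(3 + L)\<^sup>2 \<le> (L * log 2 L)\<^sup>2" using False by (intro power_mono) auto
  then show ?thesis by simp
qed

theorem theorem1:
  shows "\<exists>C::real. C > 0 \<and>
    (\<forall>n::nat. \<forall>f::bool list \<Rightarrow> bool list \<Rightarrow> bool. \<forall>\<mu>.
      n \<ge> 1 \<longrightarrow> input_dist n \<mu> \<longrightarrow> product_dist \<mu> \<longrightarrow>
        real (CC_dist \<mu> (49/100) f) \<le> C * (IC n (1/8) f * log 2 (IC n (1/8) f))\<^sup>2 + C \<and>
        real (CC_dist \<mu> (49/100) f) \<le> C * (log 2 (prt n (1/8) f) * log 2 (log 2 (prt n (1/8) f)))\<^sup>2 + C)"
\<comment> \<open>2500 is the square of the factor 50 in the potential bound, and 49 comes from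
  \<open>square_le_log_bound\<close>.\<close>
proof (intro exI[of _ "cc_const * 2500 * 49"] conjI allI impI)
  show "0 < cc_const * 2500 * 49" using cc_const_pos by simp
next
  fix n :: nat and f :: "bool list \<Rightarrow> bool list \<Rightarrow> bool" and \<mu>
  assume \<mu>: "input_dist n \<mu>" "product_dist \<mu>"
  obtain p q where pq: "\<mu> = pair_pmf p q" using \<mu>(2) by (auto simp: product_dist_def)
  have sp: "set_pmf p \<subseteq> cube n" "set_pmf q \<subseteq> cube n"
    using \<mu>(1) set_pmf_not_empty[of p] set_pmf_not_empty[of q] by (auto simp: input_dist_def pq times_subset_iff)
  let ?X = "cube n"
  have pw: "prob_weights ?X (pmf p)" "prob_weights ?X (pmf q)"
    using sp finite_cube by (auto intro: prob_weights_pmf)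
  \<comment> \<open>Common end of both bounds: \<open>L\<close> is the information complexity or the
    logarithm of the partition bound, and \<open>1 + 50 * (L + 2)\<close> is at most
    \<open>50 * (3 + L)\<close>.\<close>
  have final: "real (CC_dist \<mu> (49/100) f) \<le> cc_const * 2500 * 49 * (L * log 2 L)\<^sup>2 + cc_const * 2500 * 49"
    if "rectangle_cover ?X ?X J w A B lab f" "-1 \<le> L"
      "rectangle_cover.pot ?X ?X J w A B (pmf p) (pmf q) \<le> 50 * (L + 2)"
    for J :: "bool list labelled_rect set" and w A B lab and L :: real
  proof -
    interpret rectangle_cover ?X ?X J w A B lab f by fact
    obtain P where P: "real (depth P) \<le> cc_const * (1 + pot (pmf p) (pmf q))\<^sup>2"
      "err ?X ?X f (pmf p) (pmf q) (deval P) \<le> 49/100"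
      using exists_protocol_quadratic[OF pw] by blast
    have "real (CC_dist \<mu> (49/100) f) \<le> real (depth P)"
      using P(2) unfolding of_nat_le_iff by (intro CC_dist_le) (simp add: pq det_err_eq_err[OF sp])
    also note P(1)
    also have "cc_const * (1 + pot (pmf p) (pmf q))\<^sup>2 \<le> cc_const * (50 * (3 + L))\<^sup>2"
      using cc_const_pos that pot_nonneg[OF pw] by (intro mult_left_mono power_mono) auto
    also have "\<dots> = cc_const * 2500 * (3 + L)\<^sup>2" unfolding power_mult_distrib by simp
    also have "\<dots> \<le> cc_const * 2500 * ((L * log 2 L)\<^sup>2 + 49)"
      using cc_const_pos that by (intro mult_left_mono square_le_log_bound) auto
    also have "\<dots> \<le> cc_const * 2500 * (49 * (L * log 2 L)\<^sup>2 + 49)"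
      using cc_const_pos by (intro mult_left_mono add_mono) auto
    finally show ?thesis by (simp add: algebra_simps)
  qed
  show "real (CC_dist \<mu> (49/100) f) \<le> cc_const * 2500 * 49 * (IC n (1/8) f * log 2 (IC n (1/8) f))\<^sup>2 + cc_const * 2500 * 49"
  proof -
    obtain w where w: "rectangle_cover ?X ?X (rects ?X) w rowset colset fst f"
      "(\<Sum>j\<in>rects ?X. w j * ent (mass ?X (pmf p) (rowset j) * mass ?X (pmf q) (colset j))) \<le> 50 * (IC n (1/8) f + 1)"
      using exists_low_entropy_cover[OF pw] by blast
    show ?thesis
      using w(2) by (intro final[OF w(1) IC_ge_minus_1[OF \<mu>(1)]]) (simp add: rectangle_cover.pot_def[OF w(1)])
  qed
  show "real (CC_dist \<mu> (49/100) f) \<le> cc_const * 2500 * 49 * (log 2 (prt n (1/8) f) * log 2 (log 2 (prt n (1/8) f)))\<^sup>2 + cc_const * 2500 * 49"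
  proof -
    obtain w where w: "prt_feasible n (1/8) f w"
      "(\<Sum>z\<in>UNIV. \<Sum>R\<in>Pow (cube n) \<times> Pow (cube n). w z R) \<le> 2 * prt n (1/8) f" and prt1: "1 \<le> prt n (1/8) f"
      by (rule prt_near_optimal)
    note rc = rectangle_cover_of_feasible[OF w(1)]
    let ?W = "\<Sum>j\<in>rects ?X. w (fst j) (snd j)"
    have W: "?W = (\<Sum>z\<in>UNIV. \<Sum>R\<in>Pow (cube n) \<times> Pow (cube n). w z R)"
      unfolding sum.cartesian_product by (simp add: case_prod_unfold)
    have W1: "1 \<le> ?W" using feasible_total_ge_1[OF w(1)] W by simp
    have L0: "0 \<le> log 2 (prt n (1/8) f)" using prt1 by simp
    have "ln ?W \<le> ln (2 * prt n (1/8) f)" using W1 w(2) W prt1 by (subst ln_le_cancel_iff) auto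
    also have "\<dots> = ln 2 * (1 + log 2 (prt n (1/8) f))"
      using prt1 by (simp add: ln_mult log_def field_simps)
    also have "\<dots> \<le> 1 * (1 + log 2 (prt n (1/8) f))"
      using ln_2_less_1 L0 by (intro mult_right_mono) auto
    finally have "ln ?W + 1 \<le> 50 * (log 2 (prt n (1/8) f) + 2)" using L0 by simp
    then have "rectangle_cover.pot ?X ?X (rects ?X) (\<lambda>j. w (fst j) (snd j)) rowset colset (pmf p) (pmf q)
        \<le> 50 * (log 2 (prt n (1/8) f) + 2)"
      using rectangle_cover.pot_le_ln_total[OF rc pw W1] by linarith
    then show ?thesis using L0 by (intro final[OF rc]) auto
  qed
qed

end
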